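(* Suppose that $\ell$ spans an extreme ray of $\Sigma_{3,6}^*$. Then $\operatorname{rank} Q_{\ell}=1$ or $\operatorname{rank} Q_{\ell}=7$.
   Context: $H_{n,d}$ is the real vector space of real forms (homogeneous polynomials) of degree $d$ in $n$ variables. $\Sigma_{n,2d}=\{p\in H_{n,2d} : p=\sum_i q_i^2 \text{ (finite sum) for some } q_i\in H_{n,d}\}$, and $\Sigma_{n,2d}^*=\{\ell\in H_{n,2d}^* : \ell(p)\ge 0 \text{ for all } p\in\Sigma_{n,2d}\}$ is its dual cone in the dual space $H_{n,2d}^*$. For $\ell\in H_{n,2d}^*$, $Q_\ell$ is the quadratic form on $H_{n,d}$ given by $Q_\ell(f)=\ell(f^2)$. *)

theory Defs
  imports
    "HOL-Analysis.Analysis"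
    "HOL-Library.Poly_Mapping"
    "HOL-Library.Function_Algebras"
begin

section \<open>Pointwise real vector space structures\<close>

instantiation poly_mapping :: (type, real_vector) real_vector
begin

lift_definition scaleR_poly_mapping :: "real \<Rightarrow> ('a \<Rightarrow>\<^sub>0 'b) \<Rightarrow> 'a \<Rightarrow>\<^sub>0 'b"
  is "\<lambda>c p m. c *\<^sub>R p m"
  by (rule finite_subset[rotated]) auto

instance
  by standard (transfer; simp add: fun_eq_iff algebra_simps)+

end

instantiation "fun" :: (type, real_vector) real_vector
begin

definition scaleR_fun :: "real \<Rightarrow> ('a \<Rightarrow> 'b) \<Rightarrow> 'a \<Rightarrow> 'b" where
  "scaleR_fun c f = (\<lambda>x. c *\<^sub>R f x)"

instance
  by standard (simp_all add: scaleR_fun_def fun_eq_iff algebra_simps)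

end

section \<open>Forms and dual cones\<close>

text \<open>
  A monomial is its exponent vector; a polynomial is the finitely supported map
  from monomials to coefficients, with the convolution product of
  \<^theory>\<open>HOL-Library.Poly_Mapping\<close>. The variables are indexed by the natural numbers.
\<close>

type_synonym poly_R = "(nat \<Rightarrow>\<^sub>0 nat) \<Rightarrow>\<^sub>0 real"

definition forms :: "nat \<Rightarrow> nat \<Rightarrow> poly_R set" where
  "forms n d = {p. \<forall>m \<in> Poly_Mapping.keys p.
     Poly_Mapping.keys m \<subseteq> {..<n} \<and> (\<Sum>i<n. Poly_Mapping.lookup m i) = d}"

text \<open>The second argument is half the degree: \<open>sos_forms n d\<close> consists of forms of degree \<open>2 * d\<close>.\<close>

definition sos_forms :: "nat \<Rightarrow> nat \<Rightarrow> poly_R set" where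
  "sos_forms n d = {p \<in> forms n (2 * d).
     \<exists>qs. set qs \<subseteq> forms n d \<and> p = (\<Sum>q\<leftarrow>qs. q\<^sup>2)}"

text \<open>
  The dual of a subspace \<open>V\<close>. Functionals on \<open>V\<close> are represented by functions on
  the ambient type that vanish off \<open>V\<close>, so that equality of functionals is equality of functions
  and the vector space operations are the pointwise ones.
\<close>

definition dual_space :: "'a::real_vector set \<Rightarrow> ('a \<Rightarrow> real) set" where
  "dual_space V = {l. (\<forall>p\<in>V. \<forall>q\<in>V. l (p + q) = l p + l q) \<and>
     (\<forall>c. \<forall>p\<in>V. l (c *\<^sub>R p) = c * l p) \<and>
     (\<forall>p. p \<notin> V \<longrightarrow> l p = 0)}"

definition sos_dual :: "nat \<Rightarrow> nat \<Rightarrow> (poly_R \<Rightarrow> real) set" where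
  "sos_dual n d = {l \<in> dual_space (forms n (2 * d)). \<forall>p \<in> sos_forms n d. 0 \<le> l p}"

text \<open>\<open>cone hull {x}\<close> is the ray of nonnegative multiples of \<open>x\<close>.\<close>

definition spans_extreme_ray :: "'a::real_vector \<Rightarrow> 'a set \<Rightarrow> bool" where
  "spans_extreme_ray x K \<longleftrightarrow> x \<noteq> 0 \<and> (cone hull {x}) face_of K"

section \<open>Rank of a quadratic form\<close>

definition polar_form :: "('a::real_vector \<Rightarrow> real) \<Rightarrow> 'a \<Rightarrow> 'a \<Rightarrow> real" where
  "polar_form Q f g = (Q (f + g) - Q f - Q g) / 2"

text \<open>
  The rank of a quadratic form \<open>Q\<close> on a subspace \<open>V\<close> is the rank of the
  linear map from \<open>V\<close> to its dual induced by the symmetric bilinear form of \<open>Q\<close>.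
\<close>

definition quadratic_rank :: "'a::real_vector set \<Rightarrow> ('a \<Rightarrow> real) \<Rightarrow> nat" where
  "quadratic_rank V Q = dim ((\<lambda>f g. if g \<in> V then polar_form Q f g else 0) ` V)"

definition Q_form :: "(poly_R \<Rightarrow> real) \<Rightarrow> poly_R \<Rightarrow> real" where
  "Q_form l f = l (f\<^sup>2)"

end

theory Submission
  imports Defs
begin

text \<open>
  Let \<open>W\<close> be the kernel of \<open>Q\<^sub>l\<close>. Extremality means that \<open>l\<close> is, up to scaling, the only functional
  vanishing on all products \<open>w * g\<close> with \<open>w \<in> W\<close> and \<open>g\<close> a cubic. Hence \<open>dim W \<ge> 3\<close> by counting
  dimensions, and if \<open>W\<close> has a real zero \<open>a\<close> then \<open>l\<close> is a multiple of the evaluation at \<open>a\<close> and the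
  rank is 1. It remains to find a real zero whenever \<open>dim W \<ge> 4\<close>.

  Choose a linear form \<open>L\<close> for which the space of quadrics \<open>q\<close> with \<open>L * q \<in> W\<close> has least dimension.
  If that space is 0, every cubic is \<open>L * q\<close> modulo \<open>W\<close>; the multiplications by \<open>x\<^sub>i / L\<close> are then
  commuting self-adjoint operators on cubics modulo \<open>W\<close>, and a common eigenvector yields a real zero.
  Otherwise positivity and the minimality of \<open>L\<close> force \<open>q * M \<in> W\<close> for every linear form \<open>M\<close>, so \<open>l\<close>
  lives on the real conic \<open>q = 0\<close>, and a similar argument applies to each real normal form of \<open>q\<close>.
\<close>

section \<open>Positive semidefinite forms on finite-dimensional spaces\<close>

text \<open>Extremality acts by perturbation: a functional \<open>\<phi>\<close> that kills all
  products of \<open>W\<close> with cubics is bounded on squares by a multiple of \<open>l\<close>,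
  so \<open>l + e \<phi>\<close> and \<open>l - e \<phi>\<close> stay in the cone for small
  \<open>e > 0\<close>, and having \<open>l\<close> as midpoint forces both onto its ray. If
  \<open>dim W \<le> 2\<close>, these products span at most 20 of the 28 dimensions of sextics,
  which leaves room for a \<open>\<phi>\<close> not proportional to \<open>l\<close>. The threshold
  4 comes from 10 = 6 + 4: the multiples of \<open>L\<close> by quadrics have dimension 6, and with
  four dimensions of \<open>W\<close> they fill the cubics once they meet \<open>W\<close> only in
  0. The zero must be real. It is read off from eigenvalues of self-adjoint operators, so no complex
  intersection points appear. The forms involved are only semidefinite, on subspaces of the
  infinite-dimensional space of polynomials; compactness is replaced by \<open>domination\<close>,
  which bounds a form that vanishes on the null vectors of \<open>B\<close> by a multiple of
  \<open>B\<close>. This estimate yields the eigenvectors, the perturbation of \<open>L\<close> and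
  the perturbation of \<open>l\<close>.\<close>

locale psd_form =
  fixes B :: "'a::real_vector \<Rightarrow> 'a \<Rightarrow> real" and E :: "'a set"
  assumes bil: "bilinear B" and sym: "B u v = B v u"
    and psd: "u \<in> E \<Longrightarrow> 0 \<le> B u u"
begin

lemmas expand = bilinear_ladd[OF bil] bilinear_radd[OF bil] bilinear_lmul[OF bil]
  bilinear_rmul[OF bil] bilinear_lsub[OF bil] bilinear_rsub[OF bil]

text \<open>Degenerate Cauchy-Schwarz: along \<open>w + t v\<close> the form is affine in
  \<open>t\<close>, so a nonzero slope would make it negative. The \<open>t\<close> defined below
  gives it the value -1.\<close>

lemma null_orthogonal:
  assumes E: "subspace E" and v: "v \<in> E" "B v v = 0" and w: "w \<in> E"
  shows "B v w = 0"
proof (rule ccontr)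
  assume ne: "B v w \<noteq> 0"
  define t where "t = - (B w w + 1) / (2 * B v w)"
  have "w + t *\<^sub>R v \<in> E"
    using E v w by (simp add: subspace_add subspace_scale)
  then have "0 \<le> B (w + t *\<^sub>R v) (w + t *\<^sub>R v)" by (rule psd)
  also have "\<dots> = B w w + 2 * t * B v w"
    using v(2) sym[of w v] by (simp add: expand algebra_simps)
  also have "2 * t * B v w = - (B w w + 1)" using ne by (simp add: t_def)
  finally show False by simp
qed

text \<open>Gram-Schmidt for a semidefinite form. The projection need not be unique: a null vector
  is orthogonal to all of \<open>E\<close>, so any coefficient serves for it.\<close>

lemma projection:
  assumes E: "subspace E" and "finite S" "S \<subseteq> E" "v \<in> E"
  shows "\<exists>p\<in>span S. \<forall>s\<in>span S. B (v - p) s = 0"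
  using assms(2-4)
proof (induction S arbitrary: v rule: finite_induct)
  case empty
  then show ?case by (auto simp: bilinear_rzero[OF bil])
next
  case (insert e S)
  have sub: "span S \<subseteq> E" using insert.prems E by (simp add: span_minimal)
  obtain pe where pe: "pe \<in> span S" "\<And>s. s \<in> span S \<Longrightarrow> B (e - pe) s = 0"
    using insert.IH[of e] insert.prems by auto
  obtain pv where pv: "pv \<in> span S" "\<And>s. s \<in> span S \<Longrightarrow> B (v - pv) s = 0"
    using insert.IH[of v] insert.prems by auto
  define e' where "e' = e - pe"
  have e'E: "e' \<in> E" using insert.prems pe(1) sub E by (auto simp: e'_def subspace_diff)
  have vE: "v - pv \<in> E" using insert.prems pv(1) sub E by (auto simp: subspace_diff)
  \<comment> \<open>For null \<open>e'\<close> the quotient is 0 by convention, and the equation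
    below holds because both of its sides vanish.\<close>
  define c where "c = B (v - pv) e' / B e' e'"
  have c: "c * B e' e' = B (v - pv) e'"
  proof (cases "B e' e' = 0")
    case True
    then have "B e' (v - pv) = 0" using null_orthogonal[OF E e'E _ vE] by simp
    then show ?thesis using True by (simp add: sym)
  qed (simp add: c_def)
  have e'sp: "e' \<in> span (insert e S)"
    unfolding e'_def by (meson insertI1 pe(1) span_base span_diff span_mono subset_insertI subsetD)
  show ?case
  proof (intro bexI ballI)
    show "pv + c *\<^sub>R e' \<in> span (insert e S)"
      by (meson e'sp pv(1) span_add span_mono span_scale subset_insertI subsetD)
    fix s assume "s \<in> span (insert e S)"
    then obtain k where k: "s - k *\<^sub>R e \<in> span S" by (auto simp: span_insert)
    define s0 where "s0 = s - k *\<^sub>R e + k *\<^sub>R pe"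
    have s0: "s0 \<in> span S" unfolding s0_def by (intro span_add k span_scale pe(1))
    have s: "s = s0 + k *\<^sub>R e'" by (simp add: s0_def e'_def algebra_simps)
    have "B (v - (pv + c *\<^sub>R e')) s = B (v - pv) s - c * B e' s"
      by (simp add: expand)
    also have "\<dots> = k * (B (v - pv) e' - c * B e' e')"
      using pv(2)[OF s0] pe(2)[OF s0, folded e'_def] unfolding s
      by (simp only: bilinear_radd[OF bil] bilinear_rmul[OF bil]) (simp add: algebra_simps)
    finally show "B (v - (pv + c *\<^sub>R e')) s = 0" using c by simp
  qed
qed

lemma orthogonal_insert:
  assumes E: "subspace E" and "finite S" "insert e S \<subseteq> E"
  obtains e' where "e' \<in> E" "\<And>s. s \<in> span S \<Longrightarrow> B e' s = 0" "e' \<in> span (insert e S)"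
    "\<And>u. u \<in> span (insert e S) \<Longrightarrow> \<exists>s\<in>span S. \<exists>c. u = s + c *\<^sub>R e'"
proof -
  obtain p where p: "p \<in> span S" "\<And>s. s \<in> span S \<Longrightarrow> B (e - p) s = 0"
    using projection[OF E assms(2), of e] assms(3) by auto
  show ?thesis
  proof
    have "span S \<subseteq> E" using assms by (simp add: span_minimal)
    then show "e - p \<in> E" using p assms(3) E by (auto simp: subspace_diff)
    show "e - p \<in> span (insert e S)"
      by (meson insertI1 p(1) span_base span_diff span_mono subset_insertI subsetD)
    fix u assume "u \<in> span (insert e S)"
    then obtain k where k: "u - k *\<^sub>R e \<in> span S" by (auto simp: span_insert)
    have "u - k *\<^sub>R e + k *\<^sub>R p \<in> span S" by (intro span_add k span_scale p(1))
    moreover have "u = (u - k *\<^sub>R e + k *\<^sub>R p) + k *\<^sub>R (e - p)" by (simp add: algebra_simps)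
    ultimately show "\<exists>s\<in>span S. \<exists>c. u = s + c *\<^sub>R (e - p)" by blast
  qed (use p in auto)
qed

text \<open>Continuity of \<open>f\<close> for the seminorm of \<open>B\<close>: splitting off an
  orthogonal \<open>e'\<close> makes \<open>B\<close> additive, and squaring a sum costs a factor 2.
  In \<open>domination\<close> this controls the cross term.\<close>

lemma functional_bound:
  assumes E: "subspace E" and "finite S" "S \<subseteq> E" and "linear f"
    and "\<And>u. u \<in> span S \<Longrightarrow> B u u = 0 \<Longrightarrow> f u = 0"
  shows "\<exists>C\<ge>0. \<forall>u\<in>span S. (f u)\<^sup>2 \<le> C * B u u"
  using assms(2,3,5)
proof (induction S rule: finite_induct)
  case empty
  then show ?case using \<open>linear f\<close> by (auto intro!: exI[of _ 0] simp: linear_0)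
next
  case (insert e S)
  obtain e' where e': "e' \<in> E" "\<And>s. s \<in> span S \<Longrightarrow> B e' s = 0" "e' \<in> span (insert e S)"
    "\<And>u. u \<in> span (insert e S) \<Longrightarrow> \<exists>s\<in>span S. \<exists>c. u = s + c *\<^sub>R e'"
    by (rule orthogonal_insert[OF E insert.hyps(1) insert.prems(1)]) (rule that)
  have mono: "span S \<subseteq> span (insert e S)" by (simp add: span_mono subset_insertI)
  have "\<exists>C\<ge>0. \<forall>u\<in>span S. (f u)\<^sup>2 \<le> C * B u u"
    by (rule insert.IH) (use insert.prems mono in auto)
  then obtain C where C: "C \<ge> 0" "\<And>u. u \<in> span S \<Longrightarrow> (f u)\<^sup>2 \<le> C * B u u"
    by blast
  define D where "D = (f e')\<^sup>2 / B e' e'"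
  have pe: "B e' e' \<ge> 0" using psd e' by auto
  have D: "D * B e' e' = (f e')\<^sup>2" using insert.prems(2)[OF e'(3)] by (cases "B e' e' = 0") (auto simp: D_def)
  have D0: "D \<ge> 0" using pe by (simp add: D_def)
  show ?case
  proof (intro exI[of _ "2 * C + 2 * D"] conjI ballI)
    fix u assume "u \<in> span (insert e S)"
    then obtain s c where s: "s \<in> span S" "u = s + c *\<^sub>R e'" using e'(4) by blast
    have sE: "s \<in> E" using s(1) E insert.prems(1) span_minimal[of S E] by auto
    have Bu: "B u u = B s s + c\<^sup>2 * B e' e'"
      using e'(2)[OF s(1)] sym[of s e'] by (simp add: s(2) expand power2_eq_square)
    have "(f u)\<^sup>2 = (f s + c * f e')\<^sup>2" using \<open>linear f\<close> by (simp add: s(2) linear_add linear_scale)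
    also have "\<dots> \<le> 2 * (f s)\<^sup>2 + 2 * (c\<^sup>2 * (f e')\<^sup>2)"
      using zero_le_power2[of "f s - c * f e'"] by (simp add: power2_eq_square algebra_simps)
    also have "\<dots> \<le> 2 * (C * B s s) + 2 * (c\<^sup>2 * (D * B e' e'))"
      using C(2)[OF s(1)] D by simp
    also have "\<dots> \<le> (2 * C + 2 * D) * B u u"
      unfolding Bu using C(1) D0 psd[OF sE] pe
      by (simp add: algebra_simps)
    finally show "(f u)\<^sup>2 \<le> (2 * C + 2 * D) * B u u" .
  qed (use C D0 in auto)
qed

text \<open>Replaces compactness of the unit sphere of \<open>B\<close> modulo null vectors. The
  induction adds one orthogonal vector \<open>e'\<close> at a time; \<open>functional_bound\<close>
  for \<open>A e'\<close> handles the mixed term.\<close>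

lemma domination:
  assumes E: "subspace E" and "finite S" "S \<subseteq> E" and A: "bilinear A" "\<And>u v. A u v = A v u"
    and "\<And>u w. u \<in> span S \<Longrightarrow> w \<in> span S \<Longrightarrow> B u u = 0 \<Longrightarrow> A u w = 0"
  shows "\<exists>C\<ge>0. \<forall>u\<in>span S. \<bar>A u u\<bar> \<le> C * B u u"
  using assms(2,3,6)
proof (induction S rule: finite_induct)
  case empty
  then show ?case by (auto intro!: exI[of _ 0] simp: bilinear_lzero[OF A(1)])
next
  case (insert e S)
  obtain e' where e': "e' \<in> E" "\<And>s. s \<in> span S \<Longrightarrow> B e' s = 0" "e' \<in> span (insert e S)"
    "\<And>u. u \<in> span (insert e S) \<Longrightarrow> \<exists>s\<in>span S. \<exists>c. u = s + c *\<^sub>R e'"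
    by (rule orthogonal_insert[OF E insert.hyps(1) insert.prems(1)]) (rule that)
  have mono: "span S \<subseteq> span (insert e S)" by (simp add: span_mono subset_insertI)
  have "\<exists>C\<ge>0. \<forall>u\<in>span S. \<bar>A u u\<bar> \<le> C * B u u"
    by (rule insert.IH) (use insert.prems mono in auto)
  then obtain C where C: "C \<ge> 0" "\<And>u. u \<in> span S \<Longrightarrow> \<bar>A u u\<bar> \<le> C * B u u"
    by blast
  have "linear (A e')" using A(1) by (simp add: bilinear_def)
  moreover have "A e' u = 0" if "u \<in> span S" "B u u = 0" for u
    using insert.prems(2)[of u e'] that e'(3) mono A(2) by auto
  ultimately have "\<exists>C\<ge>0. \<forall>u\<in>span S. (A e' u)\<^sup>2 \<le> C * B u u"
    using insert.prems(1) by (intro functional_bound[OF E insert.hyps(1)]) auto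
  then obtain C' where C': "C' \<ge> 0" "\<And>u. u \<in> span S \<Longrightarrow> (A e' u)\<^sup>2 \<le> C' * B u u"
    by blast
  \<comment> \<open>The summand 1 pays for the \<open>c\<^sup>2\<close> in the bound of
    \<open>2 * c * A e' s\<close>. For null \<open>e'\<close> the quotient is 0, and all terms with
    \<open>e'\<close> vanish.\<close>
  define D where "D = (1 + \<bar>A e' e'\<bar>) / B e' e'"
  have pe: "B e' e' \<ge> 0" using psd e' by auto
  have D0: "D \<ge> 0" using pe by (simp add: D_def)
  show ?case
  proof (intro exI[of _ "C + C' + D"] conjI ballI)
    fix u assume "u \<in> span (insert e S)"
    then obtain s c where s: "s \<in> span S" "u = s + c *\<^sub>R e'" using e'(4) by blast
    have sE: "s \<in> E" using s(1) E insert.prems(1) span_minimal[of S E] by auto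
    note ps = psd[OF sE]
    have Bu: "B u u = B s s + c\<^sup>2 * B e' e'"
      using e'(2)[OF s(1)] sym[of s e'] by (simp add: s(2) expand power2_eq_square)
    have Au: "A u u = A s s + 2 * c * A e' s + c\<^sup>2 * A e' e'"
      using A(2)[of s e'] by (simp add: s(2) bilinear_ladd[OF A(1)] bilinear_radd[OF A(1)]
        bilinear_lmul[OF A(1)] bilinear_rmul[OF A(1)] power2_eq_square algebra_simps)
    have "\<bar>A u u\<bar> \<le> C * B s s + C' * B s s + D * (c\<^sup>2 * B e' e')"
    proof (cases "B e' e' = 0")
      case True
      then have "A e' s = 0" "A e' e' = 0" using insert.prems(2)[OF e'(3)] e'(3) s(1) mono by auto
      moreover have "C' * B s s \<ge> 0" using C' ps by simp
      ultimately show ?thesis using C(2)[OF s(1)] True by (simp add: Au)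
    next
      case False
      have "D * B e' e' = 1 + \<bar>A e' e'\<bar>" using False by (simp add: D_def)
      then have Dc: "D * (c\<^sup>2 * B e' e') = c\<^sup>2 + c\<^sup>2 * \<bar>A e' e'\<bar>"
        by (metis (no_types, opaque_lifting) distrib_left mult.commute mult.left_commute mult_1_right)
      have "\<bar>2 * c * A e' s\<bar> \<le> c\<^sup>2 + (A e' s)\<^sup>2"
        using zero_le_power2[of "c - A e' s"] zero_le_power2[of "c + A e' s"]
        by (simp add: power2_eq_square algebra_simps abs_le_iff)
      moreover have "\<bar>c\<^sup>2 * A e' e'\<bar> = c\<^sup>2 * \<bar>A e' e'\<bar>" by (simp add: abs_mult)
      ultimately show ?thesis using C(2)[OF s(1)] C'(2)[OF s(1)] unfolding Dc Au by linarith
    qed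
    also have "\<dots> \<le> (C + C' + D) * B u u"
    proof -
      have "0 \<le> C * (c\<^sup>2 * B e' e')" "0 \<le> C' * (c\<^sup>2 * B e' e')" "0 \<le> D * B s s"
        using C(1) C'(1) D0 ps pe by auto
      then show ?thesis by (simp add: Bu algebra_simps)
    qed
    finally show "\<bar>A u u\<bar> \<le> (C + C' + D) * B u u" .
  qed (use C C' D0 in auto)
qed

text \<open>If the supremum \<open>M\<close> of the Rayleigh quotient were not attained, then
  \<open>M * B - A\<close> would dominate a positive multiple of \<open>B\<close>.\<close>

lemma eigenvector:
  assumes S: "finite S" "E = span S" and A: "bilinear A" "\<And>u v. A u v = A v u"
    and null: "\<And>u w. u \<in> E \<Longrightarrow> w \<in> E \<Longrightarrow> B u u = 0 \<Longrightarrow> A u w = 0"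
    and u0: "u0 \<in> E" "B u0 u0 \<noteq> 0"
  obtains v \<mu> where "v \<in> E" "B v v \<noteq> 0" "\<And>w. w \<in> E \<Longrightarrow> A v w = \<mu> * B v w"
proof -
  have E: "subspace E" using S by simp
  have SE: "S \<subseteq> E" using S by (simp add: span_superset)
  note Aexp = bilinear_ladd[OF A(1)] bilinear_radd[OF A(1)] bilinear_lmul[OF A(1)] bilinear_rmul[OF A(1)]
  have "\<exists>C\<ge>0. \<forall>u\<in>E. \<bar>A u u\<bar> \<le> C * B u u"
    unfolding S(2) by (rule domination[OF E S(1) SE A]) (use null S(2) in blast)
  then obtain C where C: "C \<ge> 0" "\<And>u. u \<in> E \<Longrightarrow> \<bar>A u u\<bar> \<le> C * B u u"
    by blast
  define R where "R = {A u u | u. u \<in> E \<and> B u u = 1}"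
  define M where "M = Sup R"
  have unit: "A u u / B u u \<in> R" if "u \<in> E" "B u u \<noteq> 0" for u
  proof -
    have pos: "B u u > 0" using that psd[of u] by linarith
    let ?w = "(1 / sqrt (B u u)) *\<^sub>R u"
    have "B ?w ?w = 1" using pos by (simp add: expand)
    moreover have "A ?w ?w = A u u / B u u" using pos by (simp add: Aexp)
    ultimately show ?thesis using that E unfolding R_def
      by (smt (verit) mem_Collect_eq subspace_scale)
  qed
  have bdd: "bdd_above R"
  proof (rule bdd_aboveI[of _ C])
    fix x assume "x \<in> R"
    then show "x \<le> C" using C(2) unfolding R_def by fastforce
  qed
  have ne: "R \<noteq> {}" using unit[OF u0] by auto
  have leM: "A u u \<le> M * B u u" if u: "u \<in> E" for u
  proof (cases "B u u = 0")
    case True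
    then show ?thesis using null[OF u u] by simp
  next
    case False
    then have "B u u > 0" using psd[OF u] by linarith
    moreover have "A u u / B u u \<le> M" unfolding M_def using unit[OF u False] bdd by (rule cSup_upper)
    ultimately show ?thesis by (simp add: divide_le_eq)
  qed
  let ?B = "\<lambda>u v. M * B u v - A u v"
  have bil': "bilinear ?B"
    using bil A(1) unfolding bilinear_def linear_iff by (simp add: algebra_simps)
  interpret B': psd_form ?B E
    by unfold_locales (use bil' sym A(2) leM in auto)
  have "\<exists>v\<in>E. ?B v v = 0 \<and> B v v \<noteq> 0"
  proof (rule ccontr)
    assume "\<not> ?thesis"
    then have imp: "\<And>u w. u \<in> span S \<Longrightarrow> w \<in> span S \<Longrightarrow> ?B u u = 0 \<Longrightarrow> B u w = 0"
      using null_orthogonal[OF E] S(2) by blast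
    have "\<exists>C'\<ge>0. \<forall>u\<in>E. \<bar>B u u\<bar> \<le> C' * ?B u u"
      unfolding S(2) by (rule B'.domination[OF E S(1) SE bil sym imp])
    then obtain C' where C': "C' \<ge> 0" "\<And>u. u \<in> E \<Longrightarrow> \<bar>B u u\<bar> \<le> C' * ?B u u"
      by blast
    have "C' \<noteq> 0" using C'(2)[OF u0(1)] u0(2) by auto
    then have pos: "C' > 0" using C'(1) by simp
    have "x \<le> M - 1 / C'" if "x \<in> R" for x
    proof -
      obtain u where u: "u \<in> E" "B u u = 1" "x = A u u" using \<open>x \<in> R\<close> R_def by auto
      have "1 \<le> C' * (M - x)" using C'(2)[OF u(1)] u by simp
      then show ?thesis using pos by (simp add: field_simps)
    qed
    then have "M \<le> M - 1 / C'" unfolding M_def by (rule cSup_least[OF ne])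
    then show False using pos by (simp add: field_simps)
  qed
  then obtain v where v: "v \<in> E" "?B v v = 0" "B v v \<noteq> 0" by auto
  show ?thesis
  proof
    show "v \<in> E" "B v v \<noteq> 0" using v by auto
    fix w assume "w \<in> E"
    then show "A v w = M * B v w" using B'.null_orthogonal[OF E v(1,2)] by simp
  qed
qed

end

section \<open>Dimension counts for subspaces of a finite span\<close>

lemma finite_basis:
  fixes V :: "'a::real_vector set"
  assumes "subspace V" "V \<subseteq> span S" "finite S"
  obtains D where "finite D" "D \<subseteq> V" "independent D" "span D = V" "card D = dim V"
proof -
  obtain D where D: "D \<subseteq> V" "independent D" "V \<subseteq> span D" "card D = dim V"
    by (rule basis_exists)
  have "finite D" using independent_span_bound[OF assms(3) D(2)] D(1) assms(2) by auto
  moreover have "span D = V" using D assms(1) by (simp add: span_minimal subset_antisym)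
  ultimately show ?thesis using that D by blast
qed

lemma independent_card_le_dim_span:
  fixes V :: "'a::real_vector set"
  assumes "independent D" "D \<subseteq> V" "V \<subseteq> span S" "finite S"
  shows "finite D \<and> card D \<le> dim V"
proof -
  have VS: "span V \<subseteq> span S" using assms(3) by (simp add: span_minimal)
  obtain T where T: "finite T" "T \<subseteq> span V" "independent T" "span T = span V" "card T = dim (span V)"
    by (rule finite_basis[OF subspace_span VS assms(4)])
  then show ?thesis using independent_span_bound[OF T(1) assms(1)] assms(2) span_superset[of V] by auto
qed

lemma independent_Un_direct:
  fixes A D :: "'a::real_vector set"
  assumes "finite D" "independent A" "independent D" "span A \<inter> span D \<subseteq> {0}"
  shows "independent (A \<union> D)"
  using assms(1,3,4)
proof (induction D rule: finite_induct)
  case (insert b D)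
  have D: "independent D" "b \<notin> span D"
    using insert.prems(1) insert.hyps(2) by (auto simp: independent_insert)
  have sub: "span D \<subseteq> span (insert b D)" by (simp add: span_mono subset_insertI)
  have "b \<notin> span (A \<union> D)"
  proof
    assume "b \<in> span (A \<union> D)"
    then obtain v u where vu: "v \<in> span A" "u \<in> span D" "b = v + u" by (auto simp: span_Un)
    have "b - u \<in> span (insert b D)" using vu(2) sub by (simp add: span_base span_diff subsetD)
    then have "v = 0" using vu insert.prems(2) by auto
    then show False using vu D by simp
  qed
  moreover have "independent (A \<union> D)" using insert.IH D sub insert.prems(2) by blast
  ultimately show ?case by (simp add: independent_insertI)
qed (use assms in simp)

lemma span_Int_span_independent:
  fixes A D :: "'a::real_vector set"
  assumes "finite D" "independent (A \<union> D)" "A \<inter> D = {}"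
  shows "span A \<inter> span D \<subseteq> {0}"
  using assms
proof (induction D rule: finite_induct)
  case (insert b D)
  have ind: "independent (insert b (A \<union> D))" using insert.prems by simp
  moreover have "b \<notin> A \<union> D" using insert by auto
  ultimately have b: "b \<notin> span (A \<union> D)" "independent (A \<union> D)"
    by (auto simp: independent_insert)
  have IH: "span A \<inter> span D \<subseteq> {0}" using insert b by auto
  show ?case
  proof
    fix x assume x: "x \<in> span A \<inter> span (insert b D)"
    then obtain k where k: "x - k *\<^sub>R b \<in> span D" by (auto simp: span_insert)
    have "k *\<^sub>R b \<in> span (A \<union> D)"
    proof -
      have "x \<in> span (A \<union> D)" "x - k *\<^sub>R b \<in> span (A \<union> D)"
        using x k span_mono[of A "A \<union> D"] span_mono[of D "A \<union> D"] by auto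
      then have "x - (x - k *\<^sub>R b) \<in> span (A \<union> D)" by (rule span_diff)
      then show ?thesis by simp
    qed
    then have "k = 0" using b(1) span_scale[of "k *\<^sub>R b" "A \<union> D" "inverse k"] by (cases "k = 0") auto
    then show "x \<in> {0}" using k x IH by auto
  qed
qed auto

lemma complement_exists:
  fixes V :: "'a::real_vector set"
  assumes "subspace V" "subspace H" "V \<subseteq> H" "H \<subseteq> span S" "finite S"
  obtains D where "finite D" "independent D" "D \<subseteq> H" "card D + dim V = dim H"
    "V \<inter> span D = {0}" "\<And>h. h \<in> H \<Longrightarrow> \<exists>v\<in>V. \<exists>d\<in>span D. h = v + d"
proof -
  have VS: "V \<subseteq> span S" using assms by blast
  obtain BV where BV: "finite BV" "BV \<subseteq> V" "independent BV" "span BV = V" "card BV = dim V"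
    by (rule finite_basis[OF assms(1) VS \<open>finite S\<close>])
  obtain BH where BH: "BV \<subseteq> BH" "BH \<subseteq> H" "independent BH" "H \<subseteq> span BH"
    using maximal_independent_subset_extend[of BV H] BV assms(3) by blast
  have spH: "span BH = H" using BH assms(2) by (simp add: span_minimal subset_antisym)
  have fin: "finite BH" using independent_span_bound[OF assms(5) BH(3)] BH(2) assms(4) by auto
  have cardH: "card BH = dim H" using basis_card_eq_dim BH by blast
  let ?D = "BH - BV"
  show ?thesis
  proof
    show "finite ?D" "?D \<subseteq> H" using fin BH by auto
    show "independent ?D" using BH(3) independent_mono by blast
    show "card ?D + dim V = dim H"
      using BV cardH BH(1) fin by (metis card_Diff_subset card_mono le_add_diff_inverse2)
    show "V \<inter> span ?D = {0}"
      using span_Int_span_independent[of ?D BV] BH(1,3) BV(4) fin assms(1)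
        subspace_0[OF assms(1)] span_zero[of ?D] by (simp add: Un_absorb1) blast
    fix h assume "h \<in> H"
    then have "h \<in> span (BV \<union> ?D)" using BH(1,4) by (simp add: Un_absorb1 subsetD)
    then show "\<exists>v\<in>V. \<exists>d\<in>span ?D. h = v + d" unfolding span_Un BV(4) by blast
  qed
qed

text \<open>Were \<open>h\<close> outside the sum, it would extend the union of two bases to an
  independent subset of \<open>H\<close> with more than \<open>dim H\<close> elements.\<close>

lemma sum_eq_of_dim:
  fixes V U H :: "'a::real_vector set"
  assumes "subspace V" "subspace U" "V \<subseteq> H" "U \<subseteq> H" "H \<subseteq> span S" "finite S"
    and "V \<inter> U = {0}" "dim H \<le> dim V + dim U" "h \<in> H"
  shows "\<exists>v\<in>V. \<exists>u\<in>U. h = v + u"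
proof -
  have VS: "V \<subseteq> span S" using assms by blast
  obtain BV where BV: "finite BV" "BV \<subseteq> V" "independent BV" "span BV = V" "card BV = dim V"
    by (rule finite_basis[OF assms(1) VS \<open>finite S\<close>])
  have US: "U \<subseteq> span S" using assms by blast
  obtain BU where BU: "finite BU" "BU \<subseteq> U" "independent BU" "span BU = U" "card BU = dim U"
    by (rule finite_basis[OF assms(2) US \<open>finite S\<close>])
  have disj: "BV \<inter> BU = {}"
  proof -
    have "0 \<notin> BV" using BV(3) dependent_zero by auto
    moreover have "BV \<inter> BU \<subseteq> {0}" using BV(2) BU(2) assms(7) by blast
    ultimately show ?thesis by auto
  qed
  have ind: "independent (BV \<union> BU)"
    by (rule independent_Un_direct) (use assms BV BU in auto)
  have "h \<in> span (BV \<union> BU)"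
  proof (rule ccontr)
    assume n: "h \<notin> span (BV \<union> BU)"
    then have "independent (insert h (BV \<union> BU))" using ind by (simp add: independent_insertI)
    then have "card (insert h (BV \<union> BU)) \<le> dim H"
    proof -
      have "insert h (BV \<union> BU) \<subseteq> H" using assms(3,4,9) BV(2) BU(2) by auto
      then show ?thesis
        using independent_card_le_dim_span[OF \<open>independent (insert _ _)\<close> _ assms(5,6)] by simp
    qed
    moreover have "card (insert h (BV \<union> BU)) = Suc (card BV + card BU)"
      using n BV(1) BU(1) disj by (subst card_insert_disjoint) (auto simp: card_Un_disjoint span_base)
    ultimately show False using BV(5) BU(5) assms(8) by simp
  qed
  then show ?thesis unfolding span_Un BV(4) BU(4) by blast
qed

section \<open>Forms and point evaluations\<close>

lemma scaleR_single: "c *\<^sub>R Poly_Mapping.single m x = Poly_Mapping.single m (c *\<^sub>R x)"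
  by transfer (auto simp: when_def fun_eq_iff)

lemma lookup_scaleR: "Poly_Mapping.lookup (c *\<^sub>R p) m = c *\<^sub>R Poly_Mapping.lookup p m"
  by transfer simp

lemma poly_mapping_sum_singles:
  fixes p :: "'a \<Rightarrow>\<^sub>0 'b::comm_monoid_add"
  assumes "finite K" "Poly_Mapping.keys p \<subseteq> K"
  shows "p = (\<Sum>m\<in>K. Poly_Mapping.single m (Poly_Mapping.lookup p m))"
proof (rule poly_mapping_eqI)
  fix k
  show "Poly_Mapping.lookup p k = Poly_Mapping.lookup (\<Sum>m\<in>K. Poly_Mapping.single m (Poly_Mapping.lookup p m)) k"
    using assms by (auto simp: lookup_sum lookup_single when_def in_keys_iff)
qed

text \<open>Scalars become constant polynomials. This makes polynomials a real algebra and later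
  turns identities with scalars into plain ring identities.\<close>

lemma scaleR_conv_mult:
  fixes p :: "'a::monoid_add \<Rightarrow>\<^sub>0 'b::real_algebra_1"
  shows "c *\<^sub>R p = Poly_Mapping.single 0 (of_real c) * p"
proof -
  let ?K = "Poly_Mapping.keys p"
  have p: "p = (\<Sum>m\<in>?K. Poly_Mapping.single m (Poly_Mapping.lookup p m))"
    by (rule poly_mapping_sum_singles) auto
  have "c *\<^sub>R p = (\<Sum>m\<in>?K. c *\<^sub>R Poly_Mapping.single m (Poly_Mapping.lookup p m))"
    by (subst p) (rule scaleR_sum_right)
  also have "\<dots> = (\<Sum>m\<in>?K. Poly_Mapping.single 0 (of_real c) * Poly_Mapping.single m (Poly_Mapping.lookup p m))"
    by (simp add: scaleR_single mult_single scaleR_conv_of_real)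
  also have "\<dots> = Poly_Mapping.single 0 (of_real c) * p"
    by (subst p) (simp add: sum_distrib_left)
  finally show ?thesis .
qed

instance poly_mapping :: (comm_monoid_add, "{real_algebra_1, comm_ring_1}") real_algebra
  by standard (simp_all add: scaleR_conv_mult mult_ac)

lemma subspace_forms: "subspace (forms n d)"
  unfolding subspace_def
proof (intro conjI ballI allI)
  fix x y :: poly_R assume "x \<in> forms n d" "y \<in> forms n d"
  then show "x + y \<in> forms n d" using keys_add[of x y] unfolding forms_def by blast
next
  fix c :: real and x assume "x \<in> forms n d"
  moreover have "Poly_Mapping.keys (c *\<^sub>R x) \<subseteq> Poly_Mapping.keys x"
    by (auto simp: in_keys_iff lookup_scaleR)
  ultimately show "c *\<^sub>R x \<in> forms n d" unfolding forms_def by blast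
qed (simp add: forms_def)

lemma forms_mult:
  assumes "p \<in> forms n d" "q \<in> forms n e"
  shows "p * q \<in> forms n (d + e)"
  unfolding forms_def
proof (intro CollectI ballI)
  fix m assume "m \<in> Poly_Mapping.keys (p * q)"
  then obtain a b where ab: "a \<in> Poly_Mapping.keys p" "b \<in> Poly_Mapping.keys q" "m = a + b"
    using keys_mult by blast
  then show "Poly_Mapping.keys m \<subseteq> {..<n} \<and> (\<Sum>i<n. Poly_Mapping.lookup m i) = d + e"
    using assms keys_add[of a b] unfolding forms_def
    by (fastforce simp: lookup_add sum.distrib)
qed

lemma forms_mult':
  assumes "p \<in> forms n d" "q \<in> forms n e" "k = d + e"
  shows "p * q \<in> forms n k"
  using forms_mult assms by simp

lemma single_in_forms:
  "Poly_Mapping.single m c \<in> forms n d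
    \<longleftrightarrow> c = 0 \<or> Poly_Mapping.keys m \<subseteq> {..<n} \<and> (\<Sum>i<n. Poly_Mapping.lookup m i) = d"
  by (auto simp: forms_def)

section \<open>Ternary forms: splitting off variables, monomial bases, dimensions\<close>

definition var :: "nat \<Rightarrow> poly_R" where
  "var i = Poly_Mapping.single (Poly_Mapping.single i 1) 1"

lemma var_in_forms: "i < n \<Longrightarrow> var i \<in> forms n 1"
  by (simp add: var_def single_in_forms lookup_single when_def)

lemma lessThan_3: "{..<3::nat} = {0, 1, 2}"
  by auto

text \<open>The combinations on the right form a subspace, so it suffices to pull one variable out
  of each monomial.\<close>

lemma forms_3_Suc:
  assumes "p \<in> forms 3 (Suc d)"
  shows "\<exists>a\<in>forms 3 d. \<exists>b\<in>forms 3 d. \<exists>c\<in>forms 3 d. p = var 0 * a + var 1 * b + var 2 * c"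
proof -
  note F = subspace_forms[of 3 d]
  let ?T = "{var 0 * a + var 1 * b + var 2 * c | a b c. a \<in> forms 3 d \<and> b \<in> forms 3 d \<and> c \<in> forms 3 d}"
  have T: "subspace ?T"
    unfolding subspace_def
  proof (intro conjI ballI allI)
    show "0 \<in> ?T" using subspace_0[OF F] by (force intro!: exI[of _ 0])
  next
    fix x y assume "x \<in> ?T" "y \<in> ?T"
    then obtain a b c a' b' c' where "x = var 0 * a + var 1 * b + var 2 * c"
      "y = var 0 * a' + var 1 * b' + var 2 * c'" and m: "a \<in> forms 3 d" "b \<in> forms 3 d" "c \<in> forms 3 d"
      "a' \<in> forms 3 d" "b' \<in> forms 3 d" "c' \<in> forms 3 d" by blast
    then have "x + y = var 0 * (a + a') + var 1 * (b + b') + var 2 * (c + c')"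
      by (simp add: algebra_simps)
    then show "x + y \<in> ?T" using m subspace_add[OF F] by blast
  next
    fix k x assume "x \<in> ?T"
    then obtain a b c where "x = var 0 * a + var 1 * b + var 2 * c"
      and m: "a \<in> forms 3 d" "b \<in> forms 3 d" "c \<in> forms 3 d" by blast
    then have "k *\<^sub>R x = var 0 * (k *\<^sub>R a) + var 1 * (k *\<^sub>R b) + var 2 * (k *\<^sub>R c)"
      by (simp add: algebra_simps)
    then show "k *\<^sub>R x \<in> ?T" using m subspace_scale[OF F] by blast
  qed
  have "Poly_Mapping.single m (Poly_Mapping.lookup p m) \<in> ?T" if m: "m \<in> Poly_Mapping.keys p" for m
  proof -
    have km: "Poly_Mapping.keys m \<subseteq> {..<3}" and sm: "(\<Sum>i<3. Poly_Mapping.lookup m i) = Suc d"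
      using assms m by (auto simp: forms_def)
    then obtain i where i: "i < 3" "Poly_Mapping.lookup m i > 0"
      by (metis bot_nat_0.not_eq_extremum lessThan_iff nat.distinct(1) sum.neutral)
    define m' where "m' = m - Poly_Mapping.single i 1"
    have m_eq: "m = Poly_Mapping.single i 1 + m'"
      by (rule poly_mapping_eqI) (use i in \<open>auto simp: m'_def lookup_add lookup_minus lookup_single when_def\<close>)
    have "Poly_Mapping.keys m' \<subseteq> {..<3}"
      using km by (auto simp: m'_def in_keys_iff lookup_minus subset_iff)
    moreover have "(\<Sum>j<3. Poly_Mapping.lookup m' j) = d"
      using sm i(1) unfolding m_eq by (simp add: lookup_add sum.distrib lookup_single when_def)
    ultimately have g: "Poly_Mapping.single m' (Poly_Mapping.lookup p m) \<in> forms 3 d" (is "?g \<in> _")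
      by (simp add: single_in_forms)
    have eq: "Poly_Mapping.single m (Poly_Mapping.lookup p m) = var i * ?g"
      unfolding var_def mult_single by (subst m_eq) simp
    have "var i * ?g = var 0 * (if i = 0 then ?g else 0) + var 1 * (if i = 1 then ?g else 0)
        + var 2 * (if i = 2 then ?g else 0)"
      using i(1) less_Suc_eq[of i] by (auto simp: eval_nat_numeral)
    moreover have "(if i = j then ?g else 0) \<in> forms 3 d" for j
      using g subspace_0[OF F] by simp
    ultimately show ?thesis unfolding eq by blast
  qed
  then have "(\<Sum>m\<in>Poly_Mapping.keys p. Poly_Mapping.single m (Poly_Mapping.lookup p m)) \<in> ?T"
    by (rule subspace_sum[OF T])
  then have "p \<in> ?T" using poly_mapping_sum_singles[of "Poly_Mapping.keys p" p] by simp
  then show ?thesis by blast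
qed

lemma forms_0: "p \<in> forms n 0 \<Longrightarrow> \<exists>c. p = c *\<^sub>R 1"
proof -
  assume p: "p \<in> forms n 0"
  have "Poly_Mapping.keys p \<subseteq> {0}"
  proof
    fix m assume "m \<in> Poly_Mapping.keys p"
    then have m: "Poly_Mapping.keys m \<subseteq> {..<n}" "(\<Sum>i<n. Poly_Mapping.lookup m i) = 0"
      using p by (auto simp: forms_def)
    have "Poly_Mapping.keys m = {}"
    proof (rule ccontr)
      assume "Poly_Mapping.keys m \<noteq> {}"
      then obtain i where "i \<in> Poly_Mapping.keys m" by blast
      moreover from this have "i \<in> {..<n}" using m(1) by blast
      ultimately show False using m(2) by (auto simp: in_keys_iff)
    qed
    then show "m \<in> {0}" by simp
  qed
  then have "p = (\<Sum>m\<in>{0}. Poly_Mapping.single m (Poly_Mapping.lookup p m))"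
    by (intro poly_mapping_sum_singles) auto
  then have "p = Poly_Mapping.lookup p 0 *\<^sub>R 1"
    by (simp add: scaleR_conv_mult)
  then show ?thesis ..
qed

lemma one_in_forms: "1 \<in> forms n 0"
  by (simp add: forms_def)

lemma independent_singles:
  assumes "finite M"
  shows "independent ((\<lambda>m. Poly_Mapping.single m (1::real)) ` M)"
proof (rule independent_if_scalars_zero)
  fix f x
  assume s: "(\<Sum>x\<in>(\<lambda>m. Poly_Mapping.single m (1::real)) ` M. f x *\<^sub>R x) = 0"
    and "x \<in> (\<lambda>m. Poly_Mapping.single m (1::real)) ` M"
  then obtain k where k: "k \<in> M" "x = Poly_Mapping.single k 1" by auto
  have inj: "inj_on (\<lambda>m. Poly_Mapping.single m (1::real)) M"
    by (rule inj_onI) (metis lookup_single_eq lookup_single_not_eq zero_neq_one)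
  have "0 = (\<Sum>m\<in>M. f (Poly_Mapping.single m 1) *\<^sub>R Poly_Mapping.single m (1::real))"
    using s by (simp add: sum.reindex[OF inj])
  then have "0 = Poly_Mapping.lookup (\<Sum>m\<in>M. f (Poly_Mapping.single m 1) *\<^sub>R Poly_Mapping.single m (1::real)) k"
    by (metis lookup_zero)
  also have "\<dots> = f x"
    using assms k by (simp add: lookup_sum lookup_scaleR lookup_single when_def if_distrib cong: if_cong)
  finally show "f x = 0" by simp
qed (use assms in simp)

definition monomials3 :: "nat \<Rightarrow> (nat \<Rightarrow>\<^sub>0 nat) set" where
  "monomials3 d = {m. Poly_Mapping.keys m \<subseteq> {..<3} \<and> (\<Sum>i<3. Poly_Mapping.lookup m i) = d}"

text \<open>The third exponent is \<open>d\<close> minus the other two, so counting monomials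
  amounts to counting pairs with sum at most \<open>d\<close>.\<close>

lemma bij_monomials3:
  "bij_betw (\<lambda>m. (Poly_Mapping.lookup m 0, Poly_Mapping.lookup m 1)) (monomials3 d) (SIGMA i:{..d}. {..d-i})"
proof (rule bij_betwI)
  define g :: "nat \<times> nat \<Rightarrow> nat \<Rightarrow>\<^sub>0 nat" where
    "g = (\<lambda>(i, j). Poly_Mapping.single 0 i + Poly_Mapping.single 1 j + Poly_Mapping.single 2 (d - i - j))"
  show "(\<lambda>m. (Poly_Mapping.lookup m 0, Poly_Mapping.lookup m 1)) \<in> monomials3 d \<rightarrow> (SIGMA i:{..d}. {..d-i})"
    by (auto simp: monomials3_def lessThan_3)
  have lk: "Poly_Mapping.lookup (g (i, j)) k = (if k = 0 then i else if k = 1 then j else if k = 2 then d - i - j else 0)" for i j k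
    by (simp add: g_def lookup_add lookup_single when_def)
  show "g \<in> (SIGMA i:{..d}. {..d-i}) \<rightarrow> monomials3 d"
    by (auto simp: monomials3_def lessThan_3 lk in_keys_iff split: if_splits)
  show "g (Poly_Mapping.lookup m 0, Poly_Mapping.lookup m 1) = m" if "m \<in> monomials3 d" for m
  proof (rule poly_mapping_eqI)
    fix k
    show "Poly_Mapping.lookup (g (Poly_Mapping.lookup m 0, Poly_Mapping.lookup m 1)) k = Poly_Mapping.lookup m k"
      using that unfolding lk monomials3_def lessThan_3 by (auto simp: in_keys_iff subset_iff)
  qed
  show "(Poly_Mapping.lookup (g y) 0, Poly_Mapping.lookup (g y) 1) = y" for y
    by (cases y) (simp only: lk, simp)
qed

lemma finite_monomials3: "finite (monomials3 d)"
  using bij_betw_finite[OF bij_monomials3[of d]] by simp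

lemma card_monomials3: "card (monomials3 d) = (\<Sum>i\<le>d. Suc (d - i))"
  using bij_betw_same_card[OF bij_monomials3[of d]] by simp

definition form_basis :: "nat \<Rightarrow> poly_R set" where
  "form_basis d = (\<lambda>m. Poly_Mapping.single m 1) ` monomials3 d"

lemma finite_form_basis: "finite (form_basis d)"
  by (simp add: form_basis_def finite_monomials3)

lemma independent_form_basis: "independent (form_basis d)"
  unfolding form_basis_def by (rule independent_singles[OF finite_monomials3])

lemma span_form_basis: "span (form_basis d) = forms 3 d"
proof
  show "span (form_basis d) \<subseteq> forms 3 d"
    by (rule span_minimal[OF _ subspace_forms])
      (auto simp: form_basis_def monomials3_def single_in_forms)
  show "forms 3 d \<subseteq> span (form_basis d)"
  proof
    fix p assume p: "p \<in> forms 3 d"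
    have "p = (\<Sum>m\<in>Poly_Mapping.keys p. Poly_Mapping.lookup p m *\<^sub>R Poly_Mapping.single m 1)"
      using poly_mapping_sum_singles[of "Poly_Mapping.keys p" p] by (simp add: scaleR_single)
    moreover have "Poly_Mapping.single m 1 \<in> span (form_basis d)" if "m \<in> Poly_Mapping.keys p" for m
      using that p by (intro span_base) (auto simp: form_basis_def monomials3_def forms_def)
    ultimately show "p \<in> span (form_basis d)"
      by (metis (no_types, lifting) span_scale span_sum)
  qed
qed

lemma dim_forms_3: "dim (forms 3 d) = (\<Sum>i\<le>d. Suc (d - i))"
proof -
  have "inj_on (\<lambda>m. Poly_Mapping.single m (1::real)) (monomials3 d)"
    by (rule inj_onI) (metis lookup_single_eq lookup_single_not_eq zero_neq_one)
  then have "card (form_basis d) = card (monomials3 d)"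
    by (simp add: form_basis_def card_image)
  then show ?thesis
    using dim_span_eq_card_independent[OF independent_form_basis[of d]]
    by (simp add: span_form_basis card_monomials3)
qed

lemma dim_forms_3_values: "dim (forms 3 2) = 6" "dim (forms 3 3) = 10" "dim (forms 3 6) = 28"
  unfolding dim_forms_3 by (simp_all add: eval_nat_numeral)

section \<open>Evaluation at real points\<close>

definition mon_val :: "(nat \<Rightarrow> real) \<Rightarrow> (nat \<Rightarrow>\<^sub>0 nat) \<Rightarrow> real" where
  "mon_val a m = (\<Prod>i<3. a i ^ Poly_Mapping.lookup m i)"

definition ev :: "(nat \<Rightarrow> real) \<Rightarrow> poly_R \<Rightarrow> real" where
  "ev a p = (\<Sum>m\<in>Poly_Mapping.keys p. Poly_Mapping.lookup p m * mon_val a m)"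

lemma ev_superset:
  assumes "finite K" "Poly_Mapping.keys p \<subseteq> K"
  shows "ev a p = (\<Sum>m\<in>K. Poly_Mapping.lookup p m * mon_val a m)"
  unfolding ev_def using assms by (intro sum.mono_neutral_left) (auto simp: in_keys_iff)

lemma ev_add: "ev a (p + q) = ev a p + ev a q"
proof -
  let ?K = "Poly_Mapping.keys p \<union> Poly_Mapping.keys q"
  have "ev a (p + q) = (\<Sum>m\<in>?K. Poly_Mapping.lookup (p + q) m * mon_val a m)"
    by (rule ev_superset) (use keys_add[of p q] in auto)
  also have "\<dots> = ev a p + ev a q"
    by (simp add: ev_superset[of ?K p] ev_superset[of ?K q] lookup_add sum.distrib algebra_simps)
  finally show ?thesis .
qed

lemma ev_scaleR: "ev a (c *\<^sub>R p) = c * ev a p"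
proof -
  have "ev a (c *\<^sub>R p) = (\<Sum>m\<in>Poly_Mapping.keys p. Poly_Mapping.lookup (c *\<^sub>R p) m * mon_val a m)"
    by (rule ev_superset) (auto simp: in_keys_iff lookup_scaleR)
  then show ?thesis by (simp add: lookup_scaleR ev_def sum_distrib_left mult.assoc)
qed

lemma linear_ev: "linear (ev a)"
  by (simp add: linear_iff ev_add ev_scaleR)

lemma ev_single: "ev a (Poly_Mapping.single m c) = c * mon_val a m"
  by (simp add: ev_def)

lemma ev_mult: "ev a (p * q) = ev a p * ev a q"
proof -
  let ?s = "\<lambda>p m. Poly_Mapping.single m (Poly_Mapping.lookup p m)"
  have "p * q = (\<Sum>m\<in>Poly_Mapping.keys p. ?s p m) * (\<Sum>m\<in>Poly_Mapping.keys q. ?s q m)"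
    using poly_mapping_sum_singles[of "Poly_Mapping.keys p" p]
      poly_mapping_sum_singles[of "Poly_Mapping.keys q" q] by simp
  then have "ev a (p * q) = (\<Sum>m\<in>Poly_Mapping.keys p. \<Sum>n\<in>Poly_Mapping.keys q. ev a (?s p m * ?s q n))"
    by (simp only: sum_product linear_sum[OF linear_ev])
  also have "\<dots> = ev a p * ev a q"
    unfolding ev_def[of a p] ev_def[of a q] sum_product mult_single ev_single
    by (simp add: mon_val_def lookup_add power_add prod.distrib mult_ac)
  finally show ?thesis .
qed

lemma ev_var: "i < 3 \<Longrightarrow> ev a (var i) = a i"
  using less_Suc_eq[of i] by (auto simp: var_def ev_single mon_val_def lookup_single when_def eval_nat_numeral)

lemma ev_one: "ev a 1 = 1"
  using ev_single[of a 0 1] by (simp add: mon_val_def)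

lemmas ev_simps = ev_add ev_scaleR ev_mult ev_one linear_diff[OF linear_ev] linear_neg[OF linear_ev]
  linear_0[OF linear_ev]

lemma ev_power: "ev a (p ^ k) = ev a p ^ k"
  by (induction k) (simp_all add: ev_simps)

section \<open>Linear frames and real conics\<close>

declare One_nat_def [simp del]

lemma forms_power: "p \<in> forms n d \<Longrightarrow> p ^ k \<in> forms n (k * d)"
  by (induction k) (auto simp: one_in_forms intro: forms_mult)

text \<open>Linear coordinates on the projective plane. Spanning is what survives a change of
  coordinates most easily; independence follows from the dimension 3 and is extracted in
  \<open>dual_point\<close>.\<close>

definition linear_frame :: "poly_R \<Rightarrow> poly_R \<Rightarrow> poly_R \<Rightarrow> bool" where
  "linear_frame x y z \<longleftrightarrow> x \<in> forms 3 1 \<and> y \<in> forms 3 1 \<and> z \<in> forms 3 1 \<and>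
     (\<forall>u\<in>forms 3 1. \<exists>a b c. u = a *\<^sub>R x + b *\<^sub>R y + c *\<^sub>R z)"

lemma linear_frame_in_forms:
  assumes "linear_frame x y z"
  shows "x \<in> forms 3 1" "y \<in> forms 3 1" "z \<in> forms 3 1"
  using assms by (auto simp: linear_frame_def)

lemma linear_frame_swap:
  "linear_frame x y z \<Longrightarrow> linear_frame y x z" "linear_frame x y z \<Longrightarrow> linear_frame x z y"
proof -
  assume "linear_frame x y z"
  moreover have "a *\<^sub>R x + b *\<^sub>R y + c *\<^sub>R z = b *\<^sub>R y + a *\<^sub>R x + c *\<^sub>R z"
    "a *\<^sub>R x + b *\<^sub>R y + c *\<^sub>R z = a *\<^sub>R x + c *\<^sub>R z + b *\<^sub>R y" for a b c
    by simp_all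
  ultimately show "linear_frame y x z" "linear_frame x z y"
    unfolding linear_frame_def by metis+
qed

lemma linear_frame_rotate:
  "linear_frame x y z \<Longrightarrow> linear_frame y z x" "linear_frame x y z \<Longrightarrow> linear_frame z x y"
  "linear_frame x y z \<Longrightarrow> linear_frame z y x"
  by (blast intro: linear_frame_swap(2)[OF linear_frame_swap(1)] linear_frame_swap(1)[OF linear_frame_swap(2)]
    linear_frame_swap(2)[OF linear_frame_swap(1)[OF linear_frame_swap(2)]])+

lemma in_span3: "v = a *\<^sub>R x + b *\<^sub>R y + c *\<^sub>R z \<Longrightarrow> v \<in> span {x, y, z}"
  by (auto intro!: span_add span_scale intro: span_base)

lemma linear_frame_span:
  "linear_frame x y z \<longleftrightarrow> {x, y, z} \<subseteq> forms 3 1 \<and> forms 3 1 \<subseteq> span {x, y, z}"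
proof -
  have "(\<exists>a b c. u = a *\<^sub>R x + b *\<^sub>R y + c *\<^sub>R z) \<longleftrightarrow> u \<in> span {x, y, z}" for u
  proof
    assume "u \<in> span {x, y, z}"
    then obtain a b c where "u - a *\<^sub>R x - b *\<^sub>R y = c *\<^sub>R z"
      by (auto simp: span_insert[of x] span_insert[of y] span_singleton)
    then have "u = a *\<^sub>R x + b *\<^sub>R y + c *\<^sub>R z" by (metis add.assoc add.commute diff_add_cancel)
    then show "\<exists>a b c. u = a *\<^sub>R x + b *\<^sub>R y + c *\<^sub>R z" by blast
  next
    assume "\<exists>a b c. u = a *\<^sub>R x + b *\<^sub>R y + c *\<^sub>R z"
    then show "u \<in> span {x, y, z}" using in_span3 by blast
  qed
  then show ?thesis unfolding linear_frame_def by auto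
qed

lemma linear_frame_change:
  assumes "linear_frame x y z" "x' \<in> forms 3 1" "y' \<in> forms 3 1" "z' \<in> forms 3 1"
    and "x \<in> span {x', y', z'}" "y \<in> span {x', y', z'}" "z \<in> span {x', y', z'}"
  shows "linear_frame x' y' z'"
proof -
  have "span {x, y, z} \<subseteq> span {x', y', z'}"
    using assms(5-7) by (intro span_minimal) auto
  then show ?thesis using assms unfolding linear_frame_span by auto
qed

lemma linear_frame_vars: "linear_frame (var 0) (var 1) (var 2)"
  unfolding linear_frame_def
proof (intro conjI ballI)
  fix u assume "u \<in> forms 3 1"
  then obtain a b c where "a \<in> forms 3 0" "b \<in> forms 3 0" "c \<in> forms 3 0"
    and u: "u = var 0 * a + var 1 * b + var 2 * c"
    using forms_3_Suc[of u 0] by (auto simp: One_nat_def)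
  then obtain a' b' c' where "a = a' *\<^sub>R 1" "b = b' *\<^sub>R 1" "c = c' *\<^sub>R 1"
    using forms_0 by metis
  then show "\<exists>a b c. u = a *\<^sub>R var 0 + b *\<^sub>R var 1 + c *\<^sub>R var 2"
    by (intro exI[of _ a'] exI[of _ b'] exI[of _ c']) (simp add: u)
qed (simp_all add: var_in_forms)

lemma linear_frame_scale:
  assumes "linear_frame x y z" "k \<noteq> 0"
  shows "linear_frame (k *\<^sub>R x) y z"
proof -
  have "x = (1 / k) *\<^sub>R (k *\<^sub>R x) + 0 *\<^sub>R y + 0 *\<^sub>R z" using assms(2) by simp
  then have "x \<in> span {k *\<^sub>R x, y, z}" by (rule in_span3)
  then show ?thesis
    using assms subspace_scale[OF subspace_forms]
    by (intro linear_frame_change[OF assms(1)]) (auto simp: linear_frame_def span_base)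
qed

lemma linear_frame_shear:
  assumes "linear_frame x y z"
  shows "linear_frame (x + p *\<^sub>R y + r *\<^sub>R z) y z"
proof -
  have "x = 1 *\<^sub>R (x + p *\<^sub>R y + r *\<^sub>R z) + (- p) *\<^sub>R y + (- r) *\<^sub>R z" by simp
  then have "x \<in> span {x + p *\<^sub>R y + r *\<^sub>R z, y, z}" by (rule in_span3)
  then show ?thesis
    using assms subspace_scale[OF subspace_forms] subspace_add[OF subspace_forms]
    by (intro linear_frame_change[OF assms(1)]) (auto simp: linear_frame_def span_base)
qed

lemma linear_frame_extend:
  assumes u: "u \<in> forms 3 1" "u \<noteq> 0"
  shows "\<exists>y z. linear_frame u y z"
proof -
  have *: "\<exists>y' z'. linear_frame (a *\<^sub>R x + b *\<^sub>R y + c *\<^sub>R z) y' z'"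
    if "linear_frame x y z" "a \<noteq> 0" for x y z a b c
    using linear_frame_shear[OF linear_frame_scale[OF that], of b c] by blast
  obtain a b c where abc: "u = a *\<^sub>R var 0 + b *\<^sub>R var 1 + c *\<^sub>R var 2"
    using u linear_frame_vars unfolding linear_frame_def by blast
  consider "a \<noteq> 0" | "b \<noteq> 0" | "c \<noteq> 0" using abc u(2) by fastforce
  then show ?thesis
  proof cases
    case 1
    then show ?thesis unfolding abc by (rule *[OF linear_frame_vars])
  next
    case 2
    then show ?thesis using *[OF linear_frame_swap(1)[OF linear_frame_vars], of b a c] unfolding abc by (simp add: add_ac)
  next
    case 3
    then show ?thesis
      using *[OF linear_frame_rotate(2)[OF linear_frame_vars], of c a b] unfolding abc by (simp add: add_ac)
  qed
qed

text \<open>Three forms that span a space of dimension 3 are independent, so a linear functional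
  with the prescribed values exists; its values on the variables are the coordinates of the
  point.\<close>

lemma dual_point:
  assumes "linear_frame x y z"
  obtains a where "ev a x = \<alpha>" "ev a y = \<beta>" "ev a z = \<gamma>"
proof -
  have dim1: "dim (forms 3 1) = 3" unfolding dim_forms_3 by (simp add: eval_nat_numeral One_nat_def)
  have fr: "{x, y, z} \<subseteq> forms 3 1" "forms 3 1 \<subseteq> span {x, y, z}"
    using assms by (auto simp: linear_frame_span)
  have card3: "card {x, y, z} \<ge> 3"
    using dim_le_card[OF fr(2)] dim1 by simp
  have ne: "x \<noteq> y" "y \<noteq> z" "x \<noteq> z"
    using card3 by (auto simp: card_insert_if split: if_splits)
  have "independent {x, y, z}"
  proof (rule ccontr)
    assume "\<not> independent {x, y, z}"
    then obtain a where a: "a \<in> {x, y, z}" "a \<in> span ({x, y, z} - {a})"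
      unfolding dependent_def by blast
    have "span {x, y, z} = span ({x, y, z} - {a})"
      using span_redundant[OF a(2)] a(1) by (simp add: insert_absorb)
    then have "3 \<le> card ({x, y, z} - {a})"
      using dim_le_card[of "forms 3 1" "{x, y, z} - {a}"] fr(2) dim1 by simp
    also have "\<dots> < card {x, y, z}" using a(1) by (intro psubset_card_mono) auto
    also have "\<dots> = 3" using ne by simp
    finally show False by simp
  qed
  then obtain f where f: "linear f" "\<forall>w\<in>{x, y, z}. f w = (if w = x then \<alpha> else if w = y then \<beta> else \<gamma>)"
    using linear_independent_extend[of "{x, y, z}" "\<lambda>w. if w = x then \<alpha> else if w = y then \<beta> else \<gamma>"] by auto
  define a where "a i = f (var i)" for i
  have "ev a u = f u" if u: "u \<in> forms 3 1" for u
  proof -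
    obtain p q r where "u = p *\<^sub>R var 0 + q *\<^sub>R var 1 + r *\<^sub>R var 2"
      using u linear_frame_vars unfolding linear_frame_def by blast
    then show ?thesis
      by (simp add: ev_simps ev_var linear_add[OF f(1)] linear_scale[OF f(1)] a_def)
  qed
  then have "ev a x = \<alpha>" "ev a y = \<beta>" "ev a z = \<gamma>" using f(2) fr(1) ne by auto
  then show ?thesis by (rule that)
qed

lemma forms_Suc_frame:
  assumes "linear_frame x y z" "p \<in> forms 3 (Suc d)"
  obtains a b c where "a \<in> forms 3 d" "b \<in> forms 3 d" "c \<in> forms 3 d" "p = x * a + y * b + z * c"
proof -
  note F = subspace_forms[of 3 d]
  obtain a b c where abc: "a \<in> forms 3 d" "b \<in> forms 3 d" "c \<in> forms 3 d"
    and p: "p = var 0 * a + var 1 * b + var 2 * c"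
    using forms_3_Suc[OF assms(2)] by blast
  have "\<exists>k. var i = k 0 *\<^sub>R x + k (1::nat) *\<^sub>R y + k 2 *\<^sub>R z" if i: "i < 3" for i
  proof -
    have "var i \<in> forms 3 1" using var_in_forms[OF i] .
    then obtain k l m where "var i = k *\<^sub>R x + l *\<^sub>R y + m *\<^sub>R z"
      using assms(1) unfolding linear_frame_def by metis
    then show ?thesis by (intro exI[of _ "\<lambda>j. if j = 0 then k else if j = 1 then l else m"]) simp
  qed
  then obtain k where k: "\<And>i. i < 3 \<Longrightarrow> var i = k i 0 *\<^sub>R x + k i (1::nat) *\<^sub>R y + k i 2 *\<^sub>R z"
    by metis
  show ?thesis
  proof
    show "p = x * (k 0 0 *\<^sub>R a + k 1 0 *\<^sub>R b + k 2 0 *\<^sub>R c) + y * (k 0 1 *\<^sub>R a + k 1 1 *\<^sub>R b + k 2 1 *\<^sub>R c)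
      + z * (k 0 2 *\<^sub>R a + k 1 2 *\<^sub>R b + k 2 2 *\<^sub>R c)"
      using k[of 0] k[of 1] k[of 2] by (simp add: p algebra_simps)
  qed (intro subspace_add[OF F] subspace_scale[OF F] abc)+
qed

lemma cubic_frame:
  assumes "linear_frame x y z" "p \<in> forms 3 3"
  obtains a b c where "a \<in> forms 3 2" "b \<in> forms 3 2" "c \<in> forms 3 2" "p = x * a + y * b + z * c"
  by (rule forms_Suc_frame[OF assms(1), of p 2]) (use assms(2) that in auto)

lemma quadric_frame:
  assumes "linear_frame x y z" "p \<in> forms 3 2"
  obtains a b c where "a \<in> forms 3 1" "b \<in> forms 3 1" "c \<in> forms 3 1" "p = x * a + y * b + z * c"
  by (rule forms_Suc_frame[OF assms(1), of p 1]) (use assms(2) that in auto)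

text \<open>Turns common eigenvalues into a point: inside \<open>\<psi>\<close> a frame element
  \<open>u\<close> acts as \<open>ev a u\<close> times \<open>L\<close>, so linear factors can be
  traded for \<open>L\<close> one by one. The induction is on the degree \<open>k\<close> of the
  part not yet traded.\<close>

lemma eigenfunctional_eq_ev:
  assumes fr: "linear_frame x y z" and L: "L \<in> forms 3 1" and psi: "linear \<psi>"
    and eig: "\<And>u c. u \<in> {x, y, z} \<Longrightarrow> c \<in> forms 3 n \<Longrightarrow> \<psi> (u * c) = ev a u * \<psi> (L * c)"
    and f: "f \<in> forms 3 (Suc n)"
  shows "\<psi> f = ev a f * \<psi> (L ^ Suc n)"
proof -
  have "\<psi> (L ^ (Suc n - k) * g) = ev a g * \<psi> (L ^ Suc n)" if "k \<le> Suc n" "g \<in> forms 3 k" for k g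
    using that
  proof (induction k arbitrary: g)
    case 0
    then obtain c where "g = c *\<^sub>R 1" using forms_0 by blast
    then show ?case by (simp add: ev_simps linear_scale[OF psi])
  next
    case (Suc k)
    obtain p q r where pqr: "p \<in> forms 3 k" "q \<in> forms 3 k" "r \<in> forms 3 k" "g = x * p + y * q + z * r"
      using forms_Suc_frame[OF fr Suc.prems(2)] by blast
    let ?l = "L ^ (n - k)"
    have step: "\<psi> (?l * (u * h)) = ev a u * (ev a h * \<psi> (L ^ Suc n))"
      if u: "u \<in> {x, y, z}" and h: "h \<in> forms 3 k" for u h
    proof -
      have lf: "?l * h \<in> forms 3 n"
        using forms_mult'[OF forms_power[OF L, of "n - k"] h, of n] Suc.prems(1) by simp
      have "\<psi> (?l * (u * h)) = ev a u * \<psi> (L * (?l * h))"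
        using eig[OF u lf] by (simp add: mult_ac)
      also have "L * (?l * h) = L ^ (Suc n - k) * h"
        using Suc.prems(1) by (simp add: Suc_diff_le mult.assoc)
      also have "\<psi> \<dots> = ev a h * \<psi> (L ^ Suc n)" using Suc h by simp
      finally show ?thesis .
    qed
    have "\<psi> (?l * g) = \<psi> (?l * (x * p)) + \<psi> (?l * (y * q)) + \<psi> (?l * (z * r))"
      by (simp add: pqr(4) ring_distribs linear_add[OF psi])
    also have "\<dots> = ev a g * \<psi> (L ^ Suc n)"
      using pqr by (simp add: step ev_simps ring_distribs del: power_Suc)
    finally show ?case by simp
  qed
  from this[of "Suc n" f] f show ?thesis by simp
qed

section \<open>Normal forms of real ternary quadratic forms\<close>

abbreviation const :: "real \<Rightarrow> poly_R" where
  "const c \<equiv> Poly_Mapping.single 0 c"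

lemma scaleR_const: "c *\<^sub>R p = const c * p" for p :: poly_R
  by (simp add: scaleR_conv_mult)

lemma const_mult: "const (a * b) = const a * const b"
  by (simp add: mult_single)

lemmas const_simps = single_add single_diff single_uminus const_mult single_numeral single_one single_zero

text \<open>Two distinct real lines, a smooth conic with real points, or a semidefinite form. The
  last case gathers double lines, complex conjugate line pairs and conics without real points,
  because one positivity argument treats them all; therefore \<open>v\<close> and \<open>w\<close>
  may be zero or dependent.\<close>

definition conic_normal_form :: "poly_R \<Rightarrow> bool" where
  "conic_normal_form q \<longleftrightarrow>
     (\<exists>x y z. linear_frame x y z \<and> q = x * y) \<or>
     (\<exists>x y z. linear_frame x y z \<and> (q = x * z - y\<^sup>2 \<or> q = - (x * z - y\<^sup>2))) \<or>
     (\<exists>u v w. {u, v, w} \<subseteq> forms 3 1 \<and> u \<noteq> 0 \<and> (q = u\<^sup>2 + v\<^sup>2 + w\<^sup>2 \<or> q = - (u\<^sup>2 + v\<^sup>2 + w\<^sup>2)))"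

lemma const_sqrt: "c \<ge> 0 \<Longrightarrow> const (sqrt c) * const (sqrt c) = const c"
  by (simp add: mult_single)

text \<open>The sign of \<open>\<gamma>\<close> decides. If it is not 0, \<open>w\<close> is scaled
  by the root of its absolute value; for positive \<open>\<gamma>\<close> both \<open>m\<close> and
  the whole form change sign.\<close>

lemma conic_normal_form_product:
  assumes fr: "linear_frame m n w"
  shows "conic_normal_form (m * n + const \<gamma> * w\<^sup>2)"
proof -
  consider "\<gamma> = 0" | "\<gamma> < 0" | "\<gamma> > 0" by linarith
  then show ?thesis
  proof cases
    case 1
    then have "m * n + const \<gamma> * w\<^sup>2 = m * n" by simp
    then show ?thesis using fr unfolding conic_normal_form_def by metis
  next
    case 2
    let ?s = "sqrt (- \<gamma>)"
    have "linear_frame m (?s *\<^sub>R w) n"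
      by (rule linear_frame_swap(1)[OF linear_frame_scale[OF linear_frame_rotate(2)[OF fr]]]) (use 2 in simp)
    moreover have "const \<gamma> = - (const ?s * const ?s)" using 2 by (simp add: const_sqrt single_uminus)
    then have "m * n + const \<gamma> * w\<^sup>2 = m * n - (?s *\<^sub>R w)\<^sup>2"
      by (simp add: scaleR_const power2_eq_square mult_ac)
    ultimately show ?thesis unfolding conic_normal_form_def by blast
  next
    case 3
    let ?s = "sqrt \<gamma>"
    have "linear_frame (- 1 *\<^sub>R m) (?s *\<^sub>R w) n"
      by (intro linear_frame_scale linear_frame_swap(1)[OF linear_frame_scale[OF linear_frame_rotate(2)[OF fr]]])
        (use 3 in auto)
    moreover have "const \<gamma> = const ?s * const ?s" using 3 by (simp add: const_sqrt)
    then have "m * n + const \<gamma> * w\<^sup>2 = - ((- 1 *\<^sub>R m) * n - (?s *\<^sub>R w)\<^sup>2)"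
      unfolding scaleR_const const_simps by algebra
    ultimately show ?thesis unfolding conic_normal_form_def by blast
  qed
qed

lemma conic_normal_form_indefinite:
  assumes fr: "linear_frame u v w" and "\<alpha> > 0" "\<beta> < 0"
  shows "conic_normal_form (const \<alpha> * u\<^sup>2 + const \<beta> * v\<^sup>2 + const \<gamma> * w\<^sup>2)"
proof -
  let ?a = "sqrt \<alpha>" and ?b = "sqrt (- \<beta>)"
  have 1: "linear_frame (?a *\<^sub>R u) (?b *\<^sub>R v) w"
    by (intro linear_frame_swap(1)[OF linear_frame_scale] linear_frame_swap(1)[OF linear_frame_scale[OF fr]])
      (use assms(2,3) in auto)
  \<comment> \<open>Shears and a scaling by -2 bring the two factors of the difference of squares
    into one frame, which reduces the claim to \<open>conic_normal_form_product\<close>.\<close>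
  have 2: "linear_frame (?a *\<^sub>R u + ?b *\<^sub>R v) (?b *\<^sub>R v) w"
    using linear_frame_shear[OF 1, of 1 0] by simp
  have 3: "linear_frame (((- 2) *\<^sub>R (?b *\<^sub>R v)) + 1 *\<^sub>R (?a *\<^sub>R u + ?b *\<^sub>R v) + 0 *\<^sub>R w) (?a *\<^sub>R u + ?b *\<^sub>R v) w"
    by (intro linear_frame_shear linear_frame_scale linear_frame_swap(1)[OF 2]) simp
  have c2: "const (- 2) = - 2" by (simp add: single_uminus)
  have "(- 2) *\<^sub>R (?b *\<^sub>R v) + 1 *\<^sub>R (?a *\<^sub>R u + ?b *\<^sub>R v) + 0 *\<^sub>R w = ?a *\<^sub>R u - ?b *\<^sub>R v"
    unfolding scaleR_const c2 const_simps by algebra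
  with 3 have "linear_frame (?a *\<^sub>R u - ?b *\<^sub>R v) (?a *\<^sub>R u + ?b *\<^sub>R v) w" by argo
  from conic_normal_form_product[OF this]
  have "conic_normal_form ((?a *\<^sub>R u - ?b *\<^sub>R v) * (?a *\<^sub>R u + ?b *\<^sub>R v) + const \<gamma> * w\<^sup>2)" .
  also have "(?a *\<^sub>R u - ?b *\<^sub>R v) * (?a *\<^sub>R u + ?b *\<^sub>R v) = const \<alpha> * u\<^sup>2 + const \<beta> * v\<^sup>2"
  proof -
    have "const \<alpha> = const ?a * const ?a" "const \<beta> = - (const ?b * const ?b)"
      using assms(2,3) by (simp_all add: const_sqrt single_uminus del: mult_single)
    then show ?thesis unfolding scaleR_const by algebra
  qed
  finally show ?thesis .
qed

lemma conic_normal_form_semidefinite: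
  assumes fr: "linear_frame u v w" and nonneg: "\<alpha> \<ge> 0" "\<beta> \<ge> 0" "\<gamma> \<ge> 0"
    and q: "q = const \<alpha> * u\<^sup>2 + const \<beta> * v\<^sup>2 + const \<gamma> * w\<^sup>2" "q \<noteq> 0"
  shows "conic_normal_form q \<and> conic_normal_form (- q)"
proof -
  define u' v' w' where "u' = sqrt \<alpha> *\<^sub>R u" and "v' = sqrt \<beta> *\<^sub>R v" and "w' = sqrt \<gamma> *\<^sub>R w"
  have "const \<alpha> = const (sqrt \<alpha>) * const (sqrt \<alpha>)" "const \<beta> = const (sqrt \<beta>) * const (sqrt \<beta>)"
    "const \<gamma> = const (sqrt \<gamma>) * const (sqrt \<gamma>)"
    using nonneg by (simp_all add: const_sqrt del: mult_single)
  then have q': "q = u'\<^sup>2 + v'\<^sup>2 + w'\<^sup>2"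
    unfolding q(1) u'_def v'_def w'_def scaleR_const by algebra
  have mem: "u' \<in> forms 3 1" "v' \<in> forms 3 1" "w' \<in> forms 3 1"
    using linear_frame_in_forms[OF fr] subspace_scale[OF subspace_forms]
    by (auto simp: u'_def v'_def w'_def)
  have "u' \<noteq> 0 \<or> v' \<noteq> 0 \<or> w' \<noteq> 0" using q' q(2) by fastforce
  then consider "u' \<noteq> 0" | "v' \<noteq> 0" | "w' \<noteq> 0" by blast
  then have "\<exists>u v w. {u, v, w} \<subseteq> forms 3 1 \<and> u \<noteq> 0 \<and> q = u\<^sup>2 + v\<^sup>2 + w\<^sup>2"
  proof cases
    case 1
    then show ?thesis using mem q' by blast
  next
    case 2
    have "q = v'\<^sup>2 + u'\<^sup>2 + w'\<^sup>2" by (simp add: q')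
    then show ?thesis using mem 2 by (intro exI[of _ v'] exI[of _ u'] exI[of _ w']) simp
  next
    case 3
    have "q = w'\<^sup>2 + u'\<^sup>2 + v'\<^sup>2" by (simp add: q')
    then show ?thesis using mem 3 by (intro exI[of _ w'] exI[of _ u'] exI[of _ v']) simp
  qed
  then show ?thesis unfolding conic_normal_form_def by blast
qed

lemma conic_normal_form_diagonal:
  assumes fr: "linear_frame u v w"
    and q: "q = const \<alpha> * u\<^sup>2 + const \<beta> * v\<^sup>2 + const \<gamma> * w\<^sup>2" "q \<noteq> 0"
  shows "conic_normal_form q"
proof -
  note sw1 = linear_frame_swap(1) and sw2 = linear_frame_swap(2)
  consider "\<alpha> \<ge> 0 \<and> \<beta> \<ge> 0 \<and> \<gamma> \<ge> 0" | "\<alpha> \<le> 0 \<and> \<beta> \<le> 0 \<and> \<gamma> \<le> 0"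
    | "\<alpha> > 0" "\<beta> < 0" | "\<alpha> > 0" "\<gamma> < 0" | "\<beta> > 0" "\<alpha> < 0" | "\<beta> > 0" "\<gamma> < 0"
    | "\<gamma> > 0" "\<alpha> < 0" | "\<gamma> > 0" "\<beta> < 0" by linarith
  then show ?thesis
  proof cases
    case 1
    then show ?thesis using conic_normal_form_semidefinite[OF fr _ _ _ q] by blast
  next
    case 2
    have "- q = const (- \<alpha>) * u\<^sup>2 + const (- \<beta>) * v\<^sup>2 + const (- \<gamma>) * w\<^sup>2"
      unfolding q(1) by (simp add: single_uminus)
    then have "conic_normal_form (- (- q))"
      by (rule conic_normal_form_semidefinite[OF fr, THEN conjunct2, rotated 3]) (use 2 q(2) in auto)
    then show ?thesis by simp
  next
    case 3
    then show ?thesis using conic_normal_form_indefinite[OF fr] q by simp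
  next
    case 4
    then show ?thesis using conic_normal_form_indefinite[OF sw2[OF fr], of \<alpha> \<gamma> \<beta>] q by (simp add: add_ac)
  next
    case 5
    then show ?thesis using conic_normal_form_indefinite[OF sw1[OF fr], of \<beta> \<alpha> \<gamma>] q by (simp add: add_ac)
  next
    case 6
    then show ?thesis using conic_normal_form_indefinite[OF sw2[OF sw1[OF fr]], of \<beta> \<gamma> \<alpha>] q by (simp add: add_ac)
  next
    case 7
    then show ?thesis using conic_normal_form_indefinite[OF sw1[OF sw2[OF fr]], of \<gamma> \<alpha> \<beta>] q by (simp add: add_ac)
  next
    case 8
    then show ?thesis using conic_normal_form_indefinite[OF sw2[OF sw1[OF sw2[OF fr]]], of \<gamma> \<beta> \<alpha>] q by (simp add: add_ac)
  qed
qed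

text \<open>Completes the square in \<open>y\<close> or \<open>z\<close>; if neither square occurs,
  a nonzero mixed term is itself a product of two frame elements.\<close>

lemma conic_normal_form_cross:
  assumes fr: "linear_frame x y z"
    and q: "q = const a * x\<^sup>2 + const b * y\<^sup>2 + const c * z\<^sup>2 + const f * (y * z)" "q \<noteq> 0"
  shows "conic_normal_form q"
proof -
  have square: "conic_normal_form q" if fr: "linear_frame x y z" and "b \<noteq> 0"
    and q: "q = const a * x\<^sup>2 + const b * y\<^sup>2 + const c * z\<^sup>2 + const f * (y * z)" "q \<noteq> 0" for y z b c
  proof -
    define p where "p = f / (2 * b)"
    have "const f = const (2 * b * p)" using \<open>b \<noteq> 0\<close> by (simp add: p_def)
    then have "const f = 2 * const b * const p" by (simp add: const_mult del: mult_single)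
    then have "q = const a * x\<^sup>2 + const b * (y + p *\<^sub>R z + 0 *\<^sub>R x)\<^sup>2 + const (c - b * p * p) * z\<^sup>2"
      unfolding q(1) scaleR_const const_simps by algebra
    then show ?thesis
      by (rule conic_normal_form_diagonal[OF linear_frame_rotate(2)[OF linear_frame_shear
            [OF linear_frame_rotate(1)[OF fr], of p 0]] _ q(2)])
  qed
  consider "b \<noteq> 0" | "c \<noteq> 0" | "b = 0" "c = 0" "f = 0" | "b = 0" "c = 0" "f \<noteq> 0" by blast
  then show ?thesis
  proof cases
    case 1
    then show ?thesis using square[OF fr _ q] by simp
  next
    case 2
    then show ?thesis using square[OF linear_frame_swap(2)[OF fr], of c b] q by (simp add: add_ac mult_ac)
  next
    case 3
    then have "q = const a * x\<^sup>2 + const 0 * y\<^sup>2 + const 0 * z\<^sup>2" using q(1) by simp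
    then show ?thesis by (rule conic_normal_form_diagonal[OF fr _ q(2)])
  next
    case 4
    have "linear_frame (f *\<^sub>R z) y x"
      by (rule linear_frame_scale[OF linear_frame_rotate(3)[OF fr] 4(3)])
    from conic_normal_form_product[OF this, of a] show ?thesis
      unfolding q(1) 4 by (simp add: scaleR_const add_ac mult_ac)
  qed
qed

text \<open>Completes the square in a variable whose square occurs. If none occurs and
  \<open>d\<close> is not 0, the form is \<open>(d x + f z) (y + (e/d) z)\<close> minus
  \<open>f e/d\<close> times the square of \<open>z\<close>; the other mixed terms follow by
  permuting the frame.\<close>

lemma conic_normal_form_frame:
  assumes fr: "linear_frame x y z"
    and q: "q = const a * x\<^sup>2 + const b * y\<^sup>2 + const c * z\<^sup>2 + const d * (x * y) + const e * (x * z)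
      + const f * (y * z)" "q \<noteq> 0"
  shows "conic_normal_form q"
proof -
  note sw1 = linear_frame_swap(1) and sw2 = linear_frame_swap(2)
  have square: "conic_normal_form q" if fr: "linear_frame x y z" and "a \<noteq> 0"
    and q: "q = const a * x\<^sup>2 + const b * y\<^sup>2 + const c * z\<^sup>2 + const d * (x * y) + const e * (x * z)
      + const f * (y * z)" "q \<noteq> 0" for x y z a b c d e f
  proof -
    define p r where "p = d / (2 * a)" and "r = e / (2 * a)"
    have "const d = const (2 * a * p)" "const e = const (2 * a * r)" using \<open>a \<noteq> 0\<close> by (simp_all add: p_def r_def)
    then have "const d = 2 * const a * const p" "const e = 2 * const a * const r"
      by (simp_all add: const_mult del: mult_single)
    then have "q = const a * (x + p *\<^sub>R y + r *\<^sub>R z)\<^sup>2 + const (b - a * p * p) * y\<^sup>2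
        + const (c - a * r * r) * z\<^sup>2 + const (f - 2 * a * p * r) * (y * z)"
      unfolding q(1) scaleR_const const_simps by algebra
    then show ?thesis using conic_normal_form_cross[OF linear_frame_shear[OF fr]] q(2) by blast
  qed
  have cross: "conic_normal_form q" if fr: "linear_frame x y z" and "d \<noteq> 0"
    and q: "q = const d * (x * y) + const e * (x * z) + const f * (y * z)" for x y z d e f
  proof -
    have 1: "linear_frame (d *\<^sub>R x + 0 *\<^sub>R y + f *\<^sub>R z) y z"
      by (intro linear_frame_shear linear_frame_scale fr \<open>d \<noteq> 0\<close>)
    have 2: "linear_frame (y + (e / d) *\<^sub>R z + 0 *\<^sub>R (d *\<^sub>R x + 0 *\<^sub>R y + f *\<^sub>R z)) z (d *\<^sub>R x + 0 *\<^sub>R y + f *\<^sub>R z)"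
      by (intro linear_frame_shear linear_frame_rotate(1)[OF 1])
    have 3: "linear_frame (d *\<^sub>R x + f *\<^sub>R z) (y + (e / d) *\<^sub>R z) z"
      using linear_frame_rotate(2)[OF 2] by simp
    have "const e = const d * const (e / d)" using \<open>d \<noteq> 0\<close> by (simp add: mult_single)
    then have "q = (d *\<^sub>R x + f *\<^sub>R z) * (y + (e / d) *\<^sub>R z) + const (- (f * (e / d))) * z\<^sup>2"
      unfolding q scaleR_const const_simps by algebra
    then show ?thesis using conic_normal_form_product[OF 3] by simp
  qed
  consider "a \<noteq> 0" | "b \<noteq> 0" | "c \<noteq> 0" | "a = 0" "b = 0" "c = 0" "d \<noteq> 0" | "a = 0" "b = 0" "c = 0" "e \<noteq> 0"
    | "a = 0" "b = 0" "c = 0" "f \<noteq> 0" | "a = 0" "b = 0" "c = 0" "d = 0" "e = 0" "f = 0" by blast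
  then show ?thesis
  proof cases
    case 1
    then show ?thesis using square[OF fr _ q] by simp
  next
    case 2
    then show ?thesis using square[OF sw1[OF fr], of b a c d f e] q by (simp add: add_ac mult_ac)
  next
    case 3
    then show ?thesis using square[OF sw1[OF sw2[OF fr]], of c a b e f d] q by (simp add: add_ac mult_ac)
  next
    case 4
    then show ?thesis using cross[OF fr, of d e f] q by simp
  next
    case 5
    then show ?thesis using cross[OF sw2[OF fr], of e d f] q by (simp add: add_ac mult_ac)
  next
    case 6
    then show ?thesis using cross[OF sw2[OF sw1[OF fr]], of f d e] q by (simp add: add_ac mult_ac)
  next
    case 7
    then show ?thesis using q by simp
  qed
qed

lemma forms_1_frame:
  assumes "linear_frame x y z" "u \<in> forms 3 1"
  obtains a b c where "u = const a * x + const b * y + const c * z"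
  using assms unfolding linear_frame_def scaleR_const by blast

lemma forms_2_frame:
  assumes fr: "linear_frame x y z" and q: "q \<in> forms 3 2"
  obtains a b c d e f where "q = const a * x\<^sup>2 + const b * y\<^sup>2 + const c * z\<^sup>2 + const d * (x * y)
    + const e * (x * z) + const f * (y * z)"
proof -
  obtain u v w where uvw: "u \<in> forms 3 1" "v \<in> forms 3 1" "w \<in> forms 3 1" "q = x * u + y * v + z * w"
    by (rule quadric_frame[OF fr q])
  obtain u1 u2 u3 where u: "u = const u1 * x + const u2 * y + const u3 * z"
    using forms_1_frame[OF fr uvw(1)] .
  obtain v1 v2 v3 where v: "v = const v1 * x + const v2 * y + const v3 * z"
    using forms_1_frame[OF fr uvw(2)] .
  obtain w1 w2 w3 where w: "w = const w1 * x + const w2 * y + const w3 * z"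
    using forms_1_frame[OF fr uvw(3)] .
  have "q = const u1 * x\<^sup>2 + const v2 * y\<^sup>2 + const w3 * z\<^sup>2 + const (u2 + v1) * (x * y)
      + const (u3 + w1) * (x * z) + const (v3 + w2) * (y * z)"
    unfolding uvw(4) u v w const_simps by algebra
  then show ?thesis by (rule that)
qed

lemma conic_normal_form:
  assumes "q \<in> forms 3 2" "q \<noteq> 0"
  shows "conic_normal_form q"
  by (rule forms_2_frame[OF linear_frame_vars assms(1)])
    (rule conic_normal_form_frame[OF linear_frame_vars _ assms(2)])

section \<open>Real zeros of the kernel\<close>

lemma forms_1_2: "u \<in> forms 3 1 \<Longrightarrow> q \<in> forms 3 2 \<Longrightarrow> u * q \<in> forms 3 3"
  by (rule forms_mult') auto

lemma forms_1_1: "u \<in> forms 3 1 \<Longrightarrow> v \<in> forms 3 1 \<Longrightarrow> u * v \<in> forms 3 2"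
  by (rule forms_mult') auto

lemma forms_3_3: "u \<in> forms 3 3 \<Longrightarrow> v \<in> forms 3 3 \<Longrightarrow> u * v \<in> forms 3 6"
  by (rule forms_mult') auto

lemmas forms_add = subspace_add[OF subspace_forms]
lemmas forms_diff = subspace_diff[OF subspace_forms]
lemmas forms_scale = subspace_scale[OF subspace_forms]

lemma forms_const: "p \<in> forms 3 d \<Longrightarrow> const c * p \<in> forms 3 d"
  using forms_scale[of p 3 d c] by (simp add: scaleR_const)

text \<open>With \<open>s = tan t\<close> and the cosines cleared, the function is continuous on the
  closed half circle and takes the values \<open>- \<delta>\<close> and \<open>\<delta>\<close> at
  its ends, which avoids growth estimates for large \<open>s\<close>.\<close>

lemma real_cubic_root:
  fixes \<alpha> \<beta> \<gamma> \<delta> :: real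
  assumes "\<delta> \<noteq> 0"
  shows "\<exists>s. \<alpha> + \<beta> * s + \<gamma> * s\<^sup>2 + \<delta> * s ^ 3 = 0"
proof -
  let ?h = "\<lambda>t. \<alpha> * cos t ^ 3 + \<beta> * cos t ^ 2 * sin t + \<gamma> * cos t * sin t ^ 2 + \<delta> * sin t ^ 3"
  have cont: "continuous_on {- (pi / 2)..pi / 2} ?h" by (intro continuous_intros)
  have ends: "?h (- (pi / 2)) = - \<delta>" "?h (pi / 2) = \<delta>" by simp_all
  have "\<exists>t\<ge>- (pi / 2). t \<le> pi / 2 \<and> ?h t = 0"
  proof (cases "\<delta> > 0")
    case True
    then show ?thesis using IVT'[OF _ _ _ cont, of 0] ends by auto
  next
    case False
    then show ?thesis using IVT2'[OF _ _ _ cont, of 0] ends by auto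
  qed
  then obtain t where t: "- (pi / 2) \<le> t" "t \<le> pi / 2" "?h t = 0" by blast
  have "t \<noteq> - (pi / 2)" "t \<noteq> pi / 2" using t(3) ends assms by (metis neg_equal_0_iff_equal)+
  then have "cos t > 0" using t by (intro cos_gt_zero_pi) auto
  then have "\<alpha> + \<beta> * tan t + \<gamma> * (tan t)\<^sup>2 + \<delta> * tan t ^ 3 = ?h t / cos t ^ 3"
    by (simp add: tan_def field_simps power2_eq_square power3_eq_cube)
  then show ?thesis using t(3) by auto
qed

text \<open>\<open>\<Lambda>\<close> stands for a linear extension of \<open>l\<close> to all
  polynomials: a nonzero \<open>l\<close>, which is zero off the sextics, is not itself linear
  there.\<close>

locale sextic_functional =
  fixes \<Lambda> :: "poly_R \<Rightarrow> real"
  assumes lin: "linear \<Lambda>" and nonneg_square: "f \<in> forms 3 3 \<Longrightarrow> 0 \<le> \<Lambda> (f * f)"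
begin

lemmas L_simps = linear_add[OF lin] linear_scale[OF lin] linear_diff[OF lin] linear_0[OF lin] linear_neg[OF lin]

definition W :: "poly_R set" where
  "W = {f \<in> forms 3 3. \<forall>g\<in>forms 3 3. \<Lambda> (f * g) = 0}"

text \<open>The second conjunct excludes the origin, where every cubic vanishes.\<close>

definition has_real_zero :: bool where
  "has_real_zero \<longleftrightarrow> (\<exists>a. (\<forall>f\<in>W. ev a f = 0) \<and> (\<exists>f\<in>forms 3 3. ev a f \<noteq> 0))"

lemma W_forms: "f \<in> W \<Longrightarrow> f \<in> forms 3 3"
  by (simp add: W_def)

lemma W_orth: "f \<in> W \<Longrightarrow> g \<in> forms 3 3 \<Longrightarrow> \<Lambda> (f * g) = 0" "f \<in> W \<Longrightarrow> g \<in> forms 3 3 \<Longrightarrow> \<Lambda> (g * f) = 0"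
  by (simp_all add: W_def mult.commute[of g f])

lemma subspace_W: "subspace W"
  unfolding subspace_def W_def
  by (auto simp: subspace_0[OF subspace_forms] forms_add forms_scale ring_distribs L_simps)

lemma bilinear_pull:
  assumes "linear S" "linear T"
  shows "bilinear (\<lambda>u v. \<Lambda> (S u * T v))"
  unfolding bilinear_def linear_iff
  by (simp add: linear_add[OF assms(1)] linear_add[OF assms(2)] linear_scale[OF assms(1)]
      linear_scale[OF assms(2)] ring_distribs L_simps)

lemma psd_form_pull:
  assumes "linear S" "\<And>u. u \<in> E \<Longrightarrow> S u \<in> forms 3 3"
  shows "psd_form (\<lambda>u v. \<Lambda> (S u * S v)) E"
  by unfold_locales (use bilinear_pull assms nonneg_square in \<open>auto simp: mult.commute\<close>)

lemma linear_times: "linear ((*) (L::poly_R))"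
  by (simp add: linear_iff ring_distribs)

lemma null_in_W:
  assumes "f \<in> forms 3 3" "\<Lambda> (f * f) = 0"
  shows "f \<in> W"
proof -
  interpret psd_form "\<lambda>u v. \<Lambda> (id u * id v)" "forms 3 3"
    by (rule psd_form_pull) (auto simp: linear_ident)
  show ?thesis
    using null_orthogonal[OF subspace_forms, of f] assms by (simp add: W_def)
qed

text \<open>Pairing with \<open>g\<close> kills \<open>W\<close> and is a nonzero multiple of the
  evaluation at \<open>a\<close>, so this evaluation kills \<open>W\<close> too.\<close>

lemma real_zeroI_functional:
  assumes g: "g \<in> forms 3 3" "g \<notin> W" and k: "\<And>f. f \<in> forms 3 3 \<Longrightarrow> \<Lambda> (g * f) = ev a f * k"
  shows has_real_zero
proof -
  obtain f where f: "f \<in> forms 3 3" "\<Lambda> (g * f) \<noteq> 0" using g by (auto simp: W_def)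
  then have "ev a f \<noteq> 0" "k \<noteq> 0" using k[OF f(1)] by auto
  moreover have "ev a h = 0" if "h \<in> W" for h
    using k[of h] W_forms[OF that] W_orth(2)[OF that g(1)] \<open>k \<noteq> 0\<close> by simp
  ultimately show ?thesis unfolding has_real_zero_def using f(1) by blast
qed

text \<open>Flatness makes multiplication by \<open>x / L\<close> a self-adjoint operator on cubics modulo \<open>W\<close>;
  \<open>F\<close> plays the part of an invariant subspace for these commuting operators.\<close>

lemma common_eigenvector_step:
  assumes L: "L \<in> forms 3 1" and flat: "\<And>h. h \<in> forms 3 3 \<Longrightarrow> \<exists>w\<in>W. \<exists>g\<in>forms 3 2. h = w + L * g"
    and F: "subspace F" "F \<subseteq> forms 3 2"
    and inv: "\<And>v y r. v \<in> F \<Longrightarrow> y \<in> forms 3 1 \<Longrightarrow> r \<in> forms 3 2 \<Longrightarrow> y * v - L * r \<in> W \<Longrightarrow> r \<in> F"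
    and ne: "\<exists>v\<in>F. L * v \<notin> W" and x: "x \<in> forms 3 1"
  obtains \<mu> F' where "F' = {v \<in> F. x * v - \<mu> *\<^sub>R (L * v) \<in> W}" "subspace F'"
    "\<And>v y r. v \<in> F' \<Longrightarrow> y \<in> forms 3 1 \<Longrightarrow> r \<in> forms 3 2 \<Longrightarrow> y * v - L * r \<in> W \<Longrightarrow> r \<in> F'"
    "\<exists>v\<in>F'. L * v \<notin> W"
proof -
  have F2: "v \<in> forms 3 2" if "v \<in> F" for v using that F(2) by blast
  interpret B: psd_form "\<lambda>u v. \<Lambda> (L * u * (L * v))" F
    by (rule psd_form_pull[OF linear_times]) (use F2 forms_1_2[OF L] in auto)
  obtain S where S: "finite S" "S \<subseteq> F" "independent S" "span S = F" "card S = dim F"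
    by (rule finite_basis[OF F(1), of "form_basis 2"]) (use F(2) in \<open>simp_all add: span_form_basis finite_form_basis\<close>)
  obtain u0 where u0: "u0 \<in> F" "L * u0 \<notin> W" using ne by blast
  have u0': "\<Lambda> (L * u0 * (L * u0)) \<noteq> 0" using null_in_W[OF forms_1_2[OF L F2[OF u0(1)]]] u0(2) by blast
  obtain v \<mu> where v: "v \<in> F" "\<Lambda> (L * v * (L * v)) \<noteq> 0"
    and eig: "\<And>w. w \<in> F \<Longrightarrow> \<Lambda> (x * v * (L * w)) = \<mu> * \<Lambda> (L * v * (L * w))"
  proof (rule B.eigenvector[OF S(1) S(4)[symmetric] bilinear_pull[OF linear_times linear_times, of x L]])
    show "\<Lambda> (x * u * (L * v)) = \<Lambda> (x * v * (L * u))" for u v by (simp add: mult_ac)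
    show "\<Lambda> (x * u * (L * w)) = 0" if "u \<in> F" "w \<in> F" "\<Lambda> (L * u * (L * u)) = 0" for u w
    proof -
      have "L * u \<in> W" using null_in_W forms_1_2[OF L] F2 that by blast
      then have "\<Lambda> (L * u * (x * w)) = 0" using W_orth forms_1_2[OF x F2[OF that(2)]] by blast
      then show ?thesis by (simp add: mult_ac)
    qed
    show "\<Lambda> (L * u0 * (L * u0)) \<noteq> 0" by (rule u0')
  qed (use u0 in auto)
  \<comment> \<open>So far the eigenvalue equation is tested only against \<open>L * w\<close> with
    \<open>w\<close> in \<open>F\<close>. Flatness writes its defect as \<open>L * r\<close> modulo
    \<open>W\<close>, invariance puts \<open>r\<close> into \<open>F\<close>, and testing against
    \<open>L * r\<close> itself shows that the defect lies in \<open>W\<close>.\<close>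
  have "x * v - \<mu> *\<^sub>R (L * v) \<in> forms 3 3"
    by (intro forms_diff forms_scale forms_1_2 x L F2 v(1))
  then obtain w0 r where w0: "w0 \<in> W" and r: "r \<in> forms 3 2" and eq: "x * v - \<mu> *\<^sub>R (L * v) = w0 + L * r"
    using flat by blast
  have "x * v - L * (r + \<mu> *\<^sub>R v) = w0" using eq by (simp add: algebra_simps)
  then have "r + \<mu> *\<^sub>R v \<in> F"
    using inv[OF v(1) x, of "r + \<mu> *\<^sub>R v"] w0 forms_add[OF r forms_scale[OF F2[OF v(1)], of \<mu>]] by simp
  then have rF: "r \<in> F"
    using subspace_diff[OF F(1) _ subspace_scale[OF F(1) v(1), of \<mu>]] by fastforce
  have "\<Lambda> (L * r * (L * r)) = \<Lambda> ((x * v - \<mu> *\<^sub>R (L * v) - w0) * (L * r))"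
    using eq by simp
  also have "\<dots> = 0"
    using eig[OF rF] W_orth(1)[OF w0 forms_1_2[OF L r]] by (simp add: left_diff_distrib L_simps)
  finally have "L * r \<in> W" using null_in_W[OF forms_1_2[OF L r]] by blast
  then have vW: "x * v - \<mu> *\<^sub>R (L * v) \<in> W" unfolding eq using w0 subspace_add[OF subspace_W] by blast
  define F' where "F' = {v \<in> F. x * v - \<mu> *\<^sub>R (L * v) \<in> W}"
  show ?thesis
  proof (rule that[OF F'_def])
    show "subspace F'"
      unfolding subspace_def F'_def
    proof (intro conjI ballI allI)
      show "0 \<in> {v \<in> F. x * v - \<mu> *\<^sub>R (L * v) \<in> W}"
        by (simp add: subspace_0 F(1) subspace_W)
    next
      fix u w assume u: "u \<in> {v \<in> F. x * v - \<mu> *\<^sub>R (L * v) \<in> W}" and w: "w \<in> {v \<in> F. x * v - \<mu> *\<^sub>R (L * v) \<in> W}"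
      have "x * (u + w) - \<mu> *\<^sub>R (L * (u + w)) = (x * u - \<mu> *\<^sub>R (L * u)) + (x * w - \<mu> *\<^sub>R (L * w))"
        by (simp add: algebra_simps)
      then show "u + w \<in> {v \<in> F. x * v - \<mu> *\<^sub>R (L * v) \<in> W}"
        using u w subspace_add[OF F(1)] subspace_add[OF subspace_W] by simp
    next
      fix c :: real and u assume u: "u \<in> {v \<in> F. x * v - \<mu> *\<^sub>R (L * v) \<in> W}"
      have "x * (c *\<^sub>R u) - \<mu> *\<^sub>R (L * (c *\<^sub>R u)) = c *\<^sub>R (x * u - \<mu> *\<^sub>R (L * u))"
        by (simp add: algebra_simps)
      then show "c *\<^sub>R u \<in> {v \<in> F. x * v - \<mu> *\<^sub>R (L * v) \<in> W}"
        using u subspace_scale[OF F(1)] subspace_scale[OF subspace_W] by simp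
    qed
    show "\<exists>v\<in>F'. L * v \<notin> W"
      using v vW W_orth(1)[OF _ forms_1_2[OF L F2[OF v(1)]]] unfolding F'_def by blast
    fix u y s
    assume u: "u \<in> F'" and y: "y \<in> forms 3 1" and s: "s \<in> forms 3 2" and yu: "y * u - L * s \<in> W"
    have sF: "s \<in> F" using inv u y s yu unfolding F'_def by blast
    have uF: "u \<in> F" and uW: "x * u - \<mu> *\<^sub>R (L * u) \<in> W" using u unfolding F'_def by auto
    let ?d = "x * s - \<mu> *\<^sub>R (L * s)"
    have d3: "?d \<in> forms 3 3" by (intro forms_diff forms_scale forms_1_2 x L s)
    have orth: "\<Lambda> (?d * (L * g)) = 0" if g: "g \<in> forms 3 2" for g
    proof -
      \<comment> \<open>Multiplications by \<open>x / L\<close> and \<open>y / L\<close> commute: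
        this identity carries the eigenvalue equation from \<open>u\<close> to its image
        \<open>s\<close> under \<open>y / L\<close>.\<close>
      have "?d * (L * g) = (x * u - \<mu> *\<^sub>R (L * u)) * (y * g) - (y * u - L * s) * (x * g - \<mu> *\<^sub>R (L * g))"
        unfolding scaleR_const by algebra
      moreover have "\<Lambda> ((x * u - \<mu> *\<^sub>R (L * u)) * (y * g)) = 0"
        by (rule W_orth(1)[OF uW forms_1_2[OF y g]])
      moreover have "\<Lambda> ((y * u - L * s) * (x * g - \<mu> *\<^sub>R (L * g))) = 0"
        by (rule W_orth(1)[OF yu]) (intro forms_diff forms_scale forms_1_2 x L g)
      ultimately show ?thesis by (simp only: L_simps)
    qed
    obtain w1 g where "w1 \<in> W" "g \<in> forms 3 2" "?d = w1 + L * g" using flat[OF d3] by blast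
    then have "\<Lambda> (?d * ?d) = \<Lambda> (?d * w1) + \<Lambda> (?d * (L * g))" by (simp only: distrib_left L_simps)
    also have "\<dots> = 0" using orth[OF \<open>g \<in> _\<close>] W_orth(2)[OF \<open>w1 \<in> W\<close> d3] by simp
    finally have "?d \<in> W" using null_in_W[OF d3] by blast
    then show "s \<in> F'" using sF unfolding F'_def by blast
  qed
qed

text \<open>One eigenvector step per variable, each inside the eigenspace of the previous one,
  leaves a common eigenvector \<open>g\<close>; the three eigenvalues are the coordinates of the
  zero.\<close>

lemma flat_real_zero:
  assumes L: "L \<in> forms 3 1" and flat: "\<And>h. h \<in> forms 3 3 \<Longrightarrow> \<exists>w\<in>W. \<exists>g\<in>forms 3 2. h = w + L * g"
    and nz: "\<not> forms 3 3 \<subseteq> W"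
  shows has_real_zero
proof -
  have ne: "\<exists>v\<in>forms 3 2. L * v \<notin> W"
  proof (rule ccontr)
    assume "\<not> ?thesis"
    then have "h \<in> W" if "h \<in> forms 3 3" for h
      using flat[OF that] subspace_add[OF subspace_W] by blast
    then show False using nz by blast
  qed
  have v: "var 0 \<in> forms 3 1" "var 1 \<in> forms 3 1" "var 2 \<in> forms 3 1" by (simp_all add: var_in_forms)
  obtain a0 F0 where F0: "F0 = {v \<in> forms 3 2. var 0 * v - a0 *\<^sub>R (L * v) \<in> W}" "subspace F0"
    "\<And>v y r. v \<in> F0 \<Longrightarrow> y \<in> forms 3 1 \<Longrightarrow> r \<in> forms 3 2 \<Longrightarrow> y * v - L * r \<in> W \<Longrightarrow> r \<in> F0"
    "\<exists>v\<in>F0. L * v \<notin> W"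
    by (rule common_eigenvector_step[OF L flat subspace_forms subset_refl _ ne v(1)]) (assumption | rule that | blast)+
  have s0: "F0 \<subseteq> forms 3 2" using F0(1) by blast
  obtain a1 F1 where F1: "F1 = {v \<in> F0. var 1 * v - a1 *\<^sub>R (L * v) \<in> W}" "subspace F1"
    "\<And>v y r. v \<in> F1 \<Longrightarrow> y \<in> forms 3 1 \<Longrightarrow> r \<in> forms 3 2 \<Longrightarrow> y * v - L * r \<in> W \<Longrightarrow> r \<in> F1"
    "\<exists>v\<in>F1. L * v \<notin> W"
    by (rule common_eigenvector_step[OF L flat F0(2) s0 F0(3,4) v(2)]) (assumption | rule that | blast)+
  have s1: "F1 \<subseteq> forms 3 2" using F1(1) s0 by blast
  obtain a2 F2 where F2: "F2 = {v \<in> F1. var 2 * v - a2 *\<^sub>R (L * v) \<in> W}" "subspace F2"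
    "\<And>v y r. v \<in> F2 \<Longrightarrow> y \<in> forms 3 1 \<Longrightarrow> r \<in> forms 3 2 \<Longrightarrow> y * v - L * r \<in> W \<Longrightarrow> r \<in> F2"
    "\<exists>v\<in>F2. L * v \<notin> W"
    by (rule common_eigenvector_step[OF L flat F1(2) s1 F1(3,4) v(3)]) (assumption | rule that | blast)+
  obtain g where "g \<in> F2" and gW: "L * g \<notin> W" using F2(4) by blast
  define a where "a i = (if i = 0 then a0 else if i = 1 then a1 else a2)" for i :: nat
  have g: "g \<in> forms 3 2" "var 0 * g - a 0 *\<^sub>R (L * g) \<in> W" "var 1 * g - a 1 *\<^sub>R (L * g) \<in> W"
    "var 2 * g - a 2 *\<^sub>R (L * g) \<in> W"
    using \<open>g \<in> F2\<close> unfolding F2(1) F1(1) F0(1) a_def by auto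
  have Lg: "L * g \<in> forms 3 3" by (rule forms_1_2[OF L g(1)])
  have psi: "linear (\<lambda>f. \<Lambda> (L * g * f))" by (simp add: linear_iff distrib_left L_simps)
  have eig: "\<Lambda> (L * g * (u * c)) = ev a u * \<Lambda> (L * g * (L * c))"
    if u: "u \<in> {var 0, var 1, var 2}" and c: "c \<in> forms 3 2" for u c
  proof -
    have "u * g - ev a u *\<^sub>R (L * g) \<in> W" using u g by (auto simp: ev_var)
    moreover have "(u * g - ev a u *\<^sub>R (L * g)) * (L * c) = L * g * (u * c) - ev a u *\<^sub>R (L * g * (L * c))"
      unfolding scaleR_const by algebra
    ultimately have "0 = \<Lambda> (L * g * (u * c) - ev a u *\<^sub>R (L * g * (L * c)))"
      using W_orth(1)[OF _ forms_1_2[OF L c]] by metis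
    then show ?thesis by (simp only: L_simps) simp
  qed
  show ?thesis
  proof (rule real_zeroI_functional[OF Lg gW])
    fix f assume "f \<in> forms 3 3"
    then show "\<Lambda> (L * g * f) = ev a f * \<Lambda> (L * g * L ^ Suc 2)"
      by (intro eigenfunctional_eq_ev[OF linear_frame_vars L psi eig]) auto
  qed
qed

section \<open>Kernels that contain all linear multiples of a quadric\<close>

lemma conic_annihilates:
  assumes q: "q \<in> forms 3 2" "\<And>l. l \<in> forms 3 1 \<Longrightarrow> q * l \<in> W" and g: "g \<in> forms 3 4"
  shows "\<Lambda> (q * g) = 0"
proof -
  obtain a b c where abc: "a \<in> forms 3 3" "b \<in> forms 3 3" "c \<in> forms 3 3"
    "g = var 0 * a + var 1 * b + var 2 * c"
    using forms_3_Suc[of g 3] g by auto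
  have "\<Lambda> (q * var i * h) = 0" if "i < 3" "h \<in> forms 3 3" for i h
    by (rule W_orth(1)) (use q(2) var_in_forms that in auto)
  then have "\<Lambda> (q * var 0 * a) = 0" "\<Lambda> (q * var 1 * b) = 0" "\<Lambda> (q * var 2 * c) = 0"
    using abc by auto
  moreover have "q * g = q * var 0 * a + q * var 1 * b + q * var 2 * c"
    by (simp add: abc(4) algebra_simps)
  ultimately show ?thesis by (simp add: L_simps)
qed

text \<open>On the conic parametrised by \<open>(1, t, t\<^sup>2)\<close> the pairs \<open>(a, b)\<close> give the cubics
  \<open>x * a + y * b\<close> vanishing at \<open>t = \<infinity>\<close>, and \<open>y * a + z * b\<close> is their multiple by \<open>t\<close>.\<close>

lemma smooth_conic_real_zero:
  assumes fr: "linear_frame x y z" and q: "\<And>l. l \<in> forms 3 1 \<Longrightarrow> (x * z - y\<^sup>2) * l \<in> W"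
    and nz: "\<not> forms 3 3 \<subseteq> W"
  shows has_real_zero
proof -
  note xyz = linear_frame_in_forms[OF fr]
  have q2: "x * z - y\<^sup>2 \<in> forms 3 2"
    unfolding power2_eq_square by (intro forms_diff forms_1_1 xyz)
  \<comment> \<open>This is the point \<open>t = \<infinity>\<close> of the conic. A cubic is some
    \<open>x * a + y * b\<close> plus its value at \<open>p\<close> times
    \<open>z ^ 3\<close>.\<close>
  obtain p where p: "ev p x = 0" "ev p y = 0" "ev p z = 1" by (rule dual_point[OF fr])
  have z3: "z ^ 3 \<in> forms 3 3" using forms_power[OF xyz(3), of 3] by simp
  have dec: "\<exists>a\<in>forms 3 2. \<exists>b\<in>forms 3 2. h = x * a + y * b + ev p h *\<^sub>R z ^ 3" if h: "h \<in> forms 3 3" for h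
  proof -
    obtain a b c where abc: "a \<in> forms 3 2" "b \<in> forms 3 2" "c \<in> forms 3 2" "h = x * a + y * b + z * c"
      by (rule cubic_frame[OF fr h])
    obtain c1 c2 c3 where c: "c1 \<in> forms 3 1" "c2 \<in> forms 3 1" "c3 \<in> forms 3 1" "c = x * c1 + y * c2 + z * c3"
      by (rule quadric_frame[OF fr abc(3)])
    obtain d1 d2 d3 where d: "c3 = const d1 * x + const d2 * y + const d3 * z"
      using forms_1_frame[OF fr c(3)] .
    have eq: "h = x * (a + z * (c1 + const d1 * z)) + y * (b + z * (c2 + const d2 * z)) + const d3 * z ^ 3"
      unfolding abc(4) c(4) d by algebra
    have "ev p h = d3" unfolding eq scaleR_const[symmetric] by (simp add: ev_simps ev_power p)
    moreover have "a + z * (c1 + const d1 * z) \<in> forms 3 2" "b + z * (c2 + const d2 * z) \<in> forms 3 2"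
      by (intro forms_add forms_1_1 forms_const abc c xyz)+
    ultimately show ?thesis using eq unfolding scaleR_const by blast
  qed
  show ?thesis
  proof (cases "\<forall>f\<in>W. ev p f = 0")
    case True
    then show ?thesis unfolding has_real_zero_def using z3 p by (metis ev_power power_one zero_neq_one)
  next
    case False
    then obtain f where f: "f \<in> W" "ev p f \<noteq> 0" by blast
    define E where "E = forms 3 2 \<times> forms 3 2"
    define S T where "S = (\<lambda>(a, b). x * a + y * b)" and "T = (\<lambda>(a, b). y * a + z * b)"
    have linST: "linear S" "linear T" by (auto simp: linear_iff S_def T_def algebra_simps)
    have S3: "S u \<in> forms 3 3" and T3: "T u \<in> forms 3 3" if "u \<in> E" for u
      using that by (auto simp: E_def S_def T_def intro!: forms_add forms_1_2 xyz)
    \<comment> \<open>If \<open>p\<close> is not a zero of \<open>W\<close>, a multiple of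
      \<open>f\<close> corrects the value of any cubic at \<open>p\<close> to 0, so \<open>S\<close>
      maps onto the cubics modulo \<open>W\<close>.\<close>
    have flat: "\<exists>w\<in>W. \<exists>u\<in>E. h = w + S u" if h: "h \<in> forms 3 3" for h
    proof -
      let ?c = "ev p h / ev p f"
      have "h - ?c *\<^sub>R f \<in> forms 3 3" by (intro forms_diff forms_scale h W_forms f)
      moreover have "ev p (h - ?c *\<^sub>R f) = 0" using f(2) by (simp add: ev_simps)
      ultimately obtain a b where "a \<in> forms 3 2" "b \<in> forms 3 2" "h - ?c *\<^sub>R f = x * a + y * b"
        using dec[of "h - ?c *\<^sub>R f"] by auto
      then have "h = ?c *\<^sub>R f + S (a, b)" "(a, b) \<in> E" by (auto simp: S_def E_def diff_eq_eq add_ac)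
      then show ?thesis using subspace_scale[OF subspace_W f(1)] by blast
    qed
    let ?B0 = "form_basis 2"
    define Bs where "Bs = (\<lambda>a. (a, 0)) ` ?B0 \<union> (\<lambda>b. (0, b)) ` ?B0"
    have "finite Bs" by (simp add: Bs_def finite_form_basis)
    have E: "E = span Bs"
    proof -
      have "linear (\<lambda>a::poly_R. (a, 0::poly_R))" "linear (\<lambda>b::poly_R. (0::poly_R, b))"
        by (simp_all add: linear_iff)
      then have "span Bs = {u + v | u v. u \<in> (\<lambda>a. (a, 0)) ` forms 3 2 \<and> v \<in> (\<lambda>b. (0, b)) ` forms 3 2}"
        unfolding Bs_def span_Un by (simp add: linear_span_image span_form_basis)
      also have "\<dots> = E"
      proof
        show "E \<subseteq> {u + v | u v. u \<in> (\<lambda>a. (a, 0)) ` forms 3 2 \<and> v \<in> (\<lambda>b. (0, b)) ` forms 3 2}"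
        proof
          fix p assume "p \<in> E"
          then obtain a b where "a \<in> forms 3 2" "b \<in> forms 3 2" "p = (a, 0) + (0, b)" by (auto simp: E_def)
          then show "p \<in> {u + v | u v. u \<in> (\<lambda>a. (a, 0)) ` forms 3 2 \<and> v \<in> (\<lambda>b. (0, b)) ` forms 3 2}" by blast
        qed
      qed (auto simp: E_def)
      finally show ?thesis ..
    qed
    interpret B: psd_form "\<lambda>u v. \<Lambda> (S u * S v)" E
      by (rule psd_form_pull[OF linST(1)]) (rule S3)
    \<comment> \<open>On the conic \<open>T\<close> is \<open>t\<close> times \<open>S\<close>, so
      the two products differ by a multiple of \<open>x * z - y\<^sup>2\<close>, which
      \<open>\<Lambda>\<close> kills.\<close>
    have sym: "\<Lambda> (T u * S v) = \<Lambda> (T v * S u)" if "u \<in> E" "v \<in> E" for u v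
    proof -
      obtain a b c d where uv: "u = (a, b)" "v = (c, d)" by (cases u, cases v)
      have "a * d - b * c \<in> forms 3 4"
        using that by (auto simp: E_def uv intro!: forms_diff forms_mult')
      then have "\<Lambda> ((x * z - y\<^sup>2) * (a * d - b * c)) = 0"
        using conic_annihilates[OF q2] q by blast
      moreover have "T v * S u = T u * S v + (x * z - y\<^sup>2) * (a * d - b * c)"
        unfolding uv S_def T_def by (simp add: algebra_simps power2_eq_square)
      ultimately show ?thesis by (simp add: L_simps)
    qed
    \<comment> \<open>\<open>eigenvector\<close> asks for symmetry everywhere, but
      \<open>sym\<close> holds only on \<open>E\<close>. The average is symmetric everywhere and
      unchanged on \<open>E\<close>.\<close>
    define A where "A u v = (\<Lambda> (T u * S v) + \<Lambda> (T v * S u)) / 2" for u v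
    have A_E: "A u v = \<Lambda> (T u * S v)" if "u \<in> E" "v \<in> E" for u v
      using sym[OF that] by (simp add: A_def)
    have "bilinear A"
      using bilinear_pull[OF linST(2,1)] unfolding A_def bilinear_def linear_iff
      by (simp add: field_simps)
    obtain u0 where u0: "u0 \<in> E" "\<Lambda> (S u0 * S u0) \<noteq> 0"
    proof -
      have "\<exists>u\<in>E. S u \<notin> W"
      proof (rule ccontr)
        assume "\<not> ?thesis"
        then have "h \<in> W" if "h \<in> forms 3 3" for h
          using flat[OF that] subspace_add[OF subspace_W] by blast
        then show False using nz by blast
      qed
      then show ?thesis using null_in_W S3 that by blast
    qed
    obtain v \<mu> where v: "v \<in> E" "\<Lambda> (S v * S v) \<noteq> 0"
      and eig: "\<And>w. w \<in> E \<Longrightarrow> A v w = \<mu> * \<Lambda> (S v * S w)"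
    proof (rule B.eigenvector[OF \<open>finite Bs\<close> E \<open>bilinear A\<close>])
      show "A u v = A v u" for u v by (simp add: A_def)
      show "A u w = 0" if uw: "u \<in> E" "w \<in> E" "\<Lambda> (S u * S u) = 0" for u w
        using W_orth(2)[OF null_in_W[OF S3[OF uw(1)] uw(3)] T3[OF uw(2)]] A_E[OF uw(2,1)]
        by (simp add: A_def)
      show "u0 \<in> E" "\<Lambda> (S u0 * S u0) \<noteq> 0" by (rule u0)+
    qed (rule that)
    define \<psi> where "\<psi> f = \<Lambda> (S v * f)" for f
    have psi: "linear \<psi>" by (simp add: \<psi>_def linear_iff distrib_left L_simps)
    have TS: "\<psi> (T w) = \<mu> * \<psi> (S w)" if "w \<in> E" for w
      using eig[OF that] sym[OF that v(1)] A_E[OF v(1) that] by (simp add: \<psi>_def mult.commute)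
    \<comment> \<open>The eigenvalue is the parameter: this is the point \<open>t = \<mu>\<close> of
      the conic.\<close>
    obtain a where a: "ev a x = 1" "ev a y = \<mu>" "ev a z = \<mu> * \<mu>" by (rule dual_point[OF fr])
    have step: "\<psi> (u * c) = ev a u * \<psi> (x * c)" if u: "u \<in> {x, y, z}" and c: "c \<in> forms 3 2" for u c
    proof -
      have "(c, 0) \<in> E" "(0, c) \<in> E" using c subspace_0[OF subspace_forms] by (auto simp: E_def)
      from TS[OF this(1)] TS[OF this(2)] have "\<psi> (y * c) = \<mu> * \<psi> (x * c)" "\<psi> (z * c) = \<mu> * \<psi> (y * c)"
        by (simp_all add: S_def T_def)
      then show ?thesis using u a by auto
    qed
    have "S v \<notin> W" using v W_orth(1)[OF _ S3[OF v(1)]] by blast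
    then show ?thesis
    proof (rule real_zeroI_functional[OF S3[OF v(1)]])
      fix f assume "f \<in> forms 3 3"
      then have "\<psi> f = ev a f * \<psi> (x ^ Suc 2)"
        by (intro eigenfunctional_eq_ev[OF fr xyz(1) psi step]) auto
      then show "\<Lambda> (S v * f) = ev a f * \<psi> (x ^ Suc 2)" by (simp add: \<psi>_def)
    qed
  qed
qed

text \<open>The line \<open>z = 0\<close> meets the line pair in \<open>p1\<close> and
  \<open>p2\<close>. Modulo \<open>z\<close> and \<open>x * y\<close> a cubic is a combination of
  \<open>x ^ 3\<close> and \<open>y ^ 3\<close> whose coefficients are its values at these points;
  \<open>det\<close> lets \<open>f\<close> and \<open>g\<close> cancel both.\<close>

lemma two_point_flat:
  assumes fr: "linear_frame x y z" and q: "\<And>l. l \<in> forms 3 1 \<Longrightarrow> x * y * l \<in> W"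
    and p1: "ev p1 x = 1" "ev p1 y = 0" "ev p1 z = 0" and p2: "ev p2 x = 0" "ev p2 y = 1" "ev p2 z = 0"
    and f: "f \<in> W" and g: "g \<in> W" and det: "ev p1 f * ev p2 g \<noteq> ev p2 f * ev p1 g"
    and h: "h \<in> forms 3 3"
  shows "\<exists>w\<in>W. \<exists>r\<in>forms 3 2. h = w + z * r"
proof -
  note xyz = linear_frame_in_forms[OF fr]
  have dec: "\<exists>r\<in>forms 3 2. \<exists>l\<in>forms 3 1. h = z * r + x * y * l + ev p1 h *\<^sub>R x ^ 3 + ev p2 h *\<^sub>R y ^ 3"
    if h: "h \<in> forms 3 3" for h
  proof -
    obtain a b c where abc: "a \<in> forms 3 2" "b \<in> forms 3 2" "c \<in> forms 3 2" "h = x * a + y * b + z * c"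
      by (rule cubic_frame[OF fr h])
    obtain a1 a2 a3 a4 a5 a6 where a: "a = const a1 * x\<^sup>2 + const a2 * y\<^sup>2 + const a3 * z\<^sup>2 + const a4 * (x * y)
      + const a5 * (x * z) + const a6 * (y * z)" by (rule forms_2_frame[OF fr abc(1)])
    obtain b1 b2 b3 b4 b5 b6 where b: "b = const b1 * x\<^sup>2 + const b2 * y\<^sup>2 + const b3 * z\<^sup>2 + const b4 * (x * y)
      + const b5 * (x * z) + const b6 * (y * z)" by (rule forms_2_frame[OF fr abc(2)])
    let ?r = "c + const a3 * (x * z) + const a5 * (x * x) + const a6 * (x * y)
      + const b3 * (y * z) + const b5 * (x * y) + const b6 * (y * y)"
    let ?l = "const a4 * x + const a2 * y + const b1 * x + const b4 * y"
    have eq: "h = z * ?r + x * y * ?l + const a1 * x ^ 3 + const b2 * y ^ 3"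
      unfolding abc(4) a b by algebra
    have "ev p1 h = a1" "ev p2 h = b2"
      unfolding eq scaleR_const[symmetric] by (simp_all add: ev_simps ev_power p1 p2)
    moreover have "?r \<in> forms 3 2" "?l \<in> forms 3 1"
      by (intro forms_add forms_const forms_1_1 xyz abc)+
    ultimately show ?thesis using eq unfolding scaleR_const by blast
  qed
  define D where "D = ev p1 f * ev p2 g - ev p2 f * ev p1 g"
  \<comment> \<open>Cramer's rule: \<open>s f + t g\<close> agrees with \<open>h\<close> at both
    points.\<close>
  define s t where "s = (ev p1 h * ev p2 g - ev p2 h * ev p1 g) / D" and "t = (ev p1 f * ev p2 h - ev p2 f * ev p1 h) / D"
  have D: "D \<noteq> 0" using det by (simp add: D_def)
  let ?k = "h - s *\<^sub>R f - t *\<^sub>R g"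
  have k3: "?k \<in> forms 3 3" by (intro forms_diff forms_scale h W_forms f g)
  have "D * ev p1 ?k = 0" "D * ev p2 ?k = 0"
    using D by (simp_all add: ev_simps s_def t_def right_diff_distrib) (simp_all add: D_def algebra_simps)
  then have "ev p1 ?k = 0" "ev p2 ?k = 0" using D by auto
  then obtain r l where rl: "r \<in> forms 3 2" "l \<in> forms 3 1" "?k = z * r + x * y * l"
    using dec[OF k3] by auto
  have "s *\<^sub>R f + t *\<^sub>R g + x * y * l \<in> W"
    by (intro subspace_add[OF subspace_W] subspace_scale[OF subspace_W] f g q rl)
  moreover have "h = (s *\<^sub>R f + t *\<^sub>R g + x * y * l) + z * r"
    using rl(3) by (simp add: algebra_simps)
  ultimately show ?thesis using rl(1) by blast
qed

text \<open>\<open>P s\<close> runs over the line \<open>y = 0\<close> and \<open>Q s\<close> over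
  \<open>x = 0\<close>; \<open>R\<close> is their common point. Without a real zero no line
  \<open>z = s x\<close> can be flat, so \<open>W\<close> has proportional values at
  \<open>P s\<close> and \<open>Q 0\<close>, and all restrictions to \<open>y = 0\<close> are
  multiples of that of one \<open>f\<close>. This restriction has no root in \<open>s\<close>, so
  its cubic coefficient, the value at \<open>R\<close>, is 0. Then \<open>R\<close> is a zero of
  \<open>W\<close> after all.\<close>

lemma line_pair_real_zero:
  assumes fr: "linear_frame x y z" and q: "\<And>l. l \<in> forms 3 1 \<Longrightarrow> x * y * l \<in> W"
    and nz: "\<not> forms 3 3 \<subseteq> W"
  shows has_real_zero
proof (rule ccontr)
  assume no_zero: "\<not> has_real_zero"
  note xyz = linear_frame_in_forms[OF fr]
  have "\<exists>a. ev a x = 1 \<and> ev a y = 0 \<and> ev a z = s" "\<exists>a. ev a x = 0 \<and> ev a y = 1 \<and> ev a z = s" for s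
    using dual_point[OF fr] by metis+
  then obtain P Q where P: "\<And>s. ev (P s) x = 1" "\<And>s. ev (P s) y = 0" "\<And>s. ev (P s) z = s"
    and Q: "\<And>s. ev (Q s) x = 0" "\<And>s. ev (Q s) y = 1" "\<And>s. ev (Q s) z = s" by metis
  obtain R where R: "ev R x = 0" "ev R y = 0" "ev R z = 1" by (rule dual_point[OF fr])
  have cubes: "x ^ 3 \<in> forms 3 3" "y ^ 3 \<in> forms 3 3" "z ^ 3 \<in> forms 3 3"
    using forms_power[OF xyz(1), of 3] forms_power[OF xyz(2), of 3] forms_power[OF xyz(3), of 3] by simp_all
  have collinear: "ev (P s) f * ev (Q 0) g = ev (Q 0) f * ev (P s) g" if f: "f \<in> W" and g: "g \<in> W" for f g s
  proof (rule ccontr)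
    assume det: "ev (P s) f * ev (Q 0) g \<noteq> ev (Q 0) f * ev (P s) g"
    \<comment> \<open>The line through \<open>P s\<close> and \<open>Q 0\<close>; replacing
      \<open>z\<close> by it keeps \<open>x\<close> and \<open>y\<close> in the frame.\<close>
    let ?z = "z + (- s) *\<^sub>R x + 0 *\<^sub>R y"
    have "linear_frame ?z x y" by (rule linear_frame_shear[OF linear_frame_rotate(2)[OF fr]])
    then have fr': "linear_frame x y ?z" by (rule linear_frame_rotate(1))
    have "has_real_zero"
    proof (rule flat_real_zero[OF linear_frame_in_forms(3)[OF fr'] _ nz])
      fix h assume h: "h \<in> forms 3 3"
      show "\<exists>w\<in>W. \<exists>r\<in>forms 3 2. h = w + ?z * r"
        by (rule two_point_flat[OF fr' q _ _ _ _ _ _ f g _ h, of "P s" "Q 0"]) (use det in \<open>simp_all add: P Q ev_simps\<close>)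
    qed
    then show False using no_zero by blast
  qed
  have "\<exists>f\<in>W. ev (Q 0) f \<noteq> 0"
    using no_zero cubes(2) Q unfolding has_real_zero_def by (metis ev_power power_one zero_neq_one)
  then obtain f where f: "f \<in> W" "ev (Q 0) f \<noteq> 0" by blast
  have ratio: "ev (P s) g = ev (Q 0) g / ev (Q 0) f * ev (P s) f" if "g \<in> W" for g s
    using collinear[OF f(1) that, of s] f(2) by (simp add: field_simps)
  have restrict: "\<exists>\<alpha> \<beta> \<gamma>. \<forall>s. ev (P s) h = \<alpha> + \<beta> * s + \<gamma> * s\<^sup>2 + ev R h * s ^ 3" if h: "h \<in> forms 3 3" for h
  proof -
    obtain a b c where abc: "a \<in> forms 3 2" "b \<in> forms 3 2" "c \<in> forms 3 2" "h = x * a + y * b + z * c"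
      by (rule cubic_frame[OF fr h])
    obtain a1 a2 a3 a4 a5 a6 where a: "a = const a1 * x\<^sup>2 + const a2 * y\<^sup>2 + const a3 * z\<^sup>2 + const a4 * (x * y)
      + const a5 * (x * z) + const a6 * (y * z)" by (rule forms_2_frame[OF fr abc(1)])
    obtain c1 c2 c3 c4 c5 c6 where c: "c = const c1 * x\<^sup>2 + const c2 * y\<^sup>2 + const c3 * z\<^sup>2 + const c4 * (x * y)
      + const c5 * (x * z) + const c6 * (y * z)" by (rule forms_2_frame[OF fr abc(3)])
    have "ev R h = c3" unfolding abc(4) c scaleR_const[symmetric] by (simp add: ev_simps ev_power R)
    moreover have "ev (P s) h = a1 + (a5 + c1) * s + (a3 + c5) * s\<^sup>2 + c3 * s ^ 3" for s
      unfolding abc(4) a c scaleR_const[symmetric]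
      by (simp add: ev_simps ev_power P) (simp add: algebra_simps power2_eq_square power3_eq_cube)
    ultimately show ?thesis by blast
  qed
  have "ev (P s) f \<noteq> 0" for s
  proof
    assume "ev (P s) f = 0"
    then have "\<forall>g\<in>W. ev (P s) g = 0" using ratio by simp
    then show False using no_zero cubes(1) P unfolding has_real_zero_def by (metis ev_power power_one zero_neq_one)
  qed
  then have Rf: "ev R f = 0"
    using real_cubic_root restrict[OF W_forms[OF f(1)]] by metis
  have "ev R g = 0" if g: "g \<in> W" for g
  proof -
    obtain \<alpha> \<beta> \<gamma> where 1: "\<And>s. ev (P s) g = \<alpha> + \<beta> * s + \<gamma> * s\<^sup>2 + ev R g * s ^ 3"
      using restrict[OF W_forms[OF g]] by blast
    obtain \<alpha>2 \<beta>2 \<gamma>2 where 2: "\<And>s. ev (P s) f = \<alpha>2 + \<beta>2 * s + \<gamma>2 * s\<^sup>2"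
      using restrict[OF W_forms[OF f(1)]] Rf by auto
    define \<kappa> where "\<kappa> = ev (Q 0) g / ev (Q 0) f"
    have "\<alpha> + \<beta> * s + \<gamma> * s\<^sup>2 + ev R g * s ^ 3 = \<kappa> * \<alpha>2 + \<kappa> * \<beta>2 * s + \<kappa> * \<gamma>2 * s\<^sup>2" for s
      using ratio[OF g, of s] unfolding 1 2 \<kappa>_def[symmetric] by (simp add: algebra_simps)
    from this[of 0] this[of 1] this[of "-1"] this[of 2] show ?thesis by simp
  qed
  then show False using no_zero cubes(3) R unfolding has_real_zero_def by (metis ev_power power_one zero_neq_one)
qed

lemma conic_real_zero:
  assumes q2: "q \<in> forms 3 2" "q \<noteq> 0" and q: "\<And>l. l \<in> forms 3 1 \<Longrightarrow> q * l \<in> W"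
    and nz: "\<not> forms 3 3 \<subseteq> W"
  shows has_real_zero
proof -
  have neg: "- q * l \<in> W" if "l \<in> forms 3 1" for l
    using q[OF that] subspace_neg[OF subspace_W] by simp
  consider x y z where "linear_frame x y z" "q = x * y"
    | x y z where "linear_frame x y z" "q = x * z - y\<^sup>2 \<or> q = - (x * z - y\<^sup>2)"
    | u v w where "{u, v, w} \<subseteq> forms 3 1" "u \<noteq> 0" "q = u\<^sup>2 + v\<^sup>2 + w\<^sup>2 \<or> q = - (u\<^sup>2 + v\<^sup>2 + w\<^sup>2)"
    using conic_normal_form[OF q2] unfolding conic_normal_form_def by blast
  then show ?thesis
  proof cases
    case 1
    then show ?thesis using line_pair_real_zero q nz by blast
  next
    case 2
    then have "x * z - y\<^sup>2 = q \<or> x * z - y\<^sup>2 = - q" by auto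
    then have "(x * z - y\<^sup>2) * l \<in> W" if "l \<in> forms 3 1" for l using q[OF that] neg[OF that] by metis
    then show ?thesis using smooth_conic_real_zero 2(1) nz by blast
  next
    case 3
    then have uvw: "u \<in> forms 3 1" "v \<in> forms 3 1" "w \<in> forms 3 1" by auto
    \<comment> \<open>Up to sign, \<open>q\<close> times the square of \<open>p\<close> is a sum of
      three squares of cubics. \<open>\<Lambda>\<close> kills the sum, hence each summand, so
      \<open>u\<close> times any quadric lies in \<open>W\<close>; the line pair of \<open>u\<close>
      and any second line then applies.\<close>
    have uW: "u * p \<in> W" if p: "p \<in> forms 3 2" for p
    proof (rule null_in_W[OF forms_1_2[OF uvw(1) p]])
      have "p * p \<in> forms 3 4" using forms_mult'[OF p p] by simp
      then have "\<Lambda> (q * (p * p)) = 0" using conic_annihilates[OF q2(1)] q by blast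
      moreover have "q * (p * p) = (u\<^sup>2 + v\<^sup>2 + w\<^sup>2) * (p * p) \<or> q * (p * p) = - ((u\<^sup>2 + v\<^sup>2 + w\<^sup>2) * (p * p))"
        using 3(3) by (auto simp only: mult_minus_left)
      ultimately have "\<Lambda> ((u\<^sup>2 + v\<^sup>2 + w\<^sup>2) * (p * p)) = 0"
        by (elim disjE) (simp_all only: L_simps neg_equal_0_iff_equal)
      moreover have "(u\<^sup>2 + v\<^sup>2 + w\<^sup>2) * (p * p) = u * p * (u * p) + v * p * (v * p) + w * p * (w * p)"
        by (simp add: power2_eq_square algebra_simps)
      ultimately show "\<Lambda> (u * p * (u * p)) = 0"
        using nonneg_square[OF forms_1_2[OF uvw(1) p]] nonneg_square[OF forms_1_2[OF uvw(2) p]]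
          nonneg_square[OF forms_1_2[OF uvw(3) p]] by (simp add: L_simps)
    qed
    obtain n z where fr: "linear_frame u n z" using linear_frame_extend[OF uvw(1) 3(2)] by blast
    have "u * n * l \<in> W" if "l \<in> forms 3 1" for l
      using uW[OF forms_1_1[OF linear_frame_in_forms(2)[OF fr] that]] by (simp add: mult.assoc)
    then show ?thesis using line_pair_real_zero[OF fr] nz by blast
  qed
qed

section \<open>Linear forms with smallest multiplication kernel\<close>

definition K :: "poly_R \<Rightarrow> poly_R set" where
  "K L = {q \<in> forms 3 2. L * q \<in> W}"

lemma subspace_K: "subspace (K L)"
  unfolding subspace_def K_def
  by (auto simp: subspace_0[OF subspace_forms] subspace_0[OF subspace_W] forms_add forms_scale distrib_left
      intro: subspace_add[OF subspace_W] subspace_scale[OF subspace_W])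

text \<open>Perturb \<open>L\<close> to \<open>L + t M\<close> and split \<open>q = r + d\<close> with \<open>r\<close> in the perturbed kernel. Then
  \<open>\<Lambda> ((M q)\<^sup>2) \<le> \<Lambda> ((M d)\<^sup>2)\<close>, whereas \<open>\<Lambda> ((M d)\<^sup>2)\<close> is of order \<open>t\<^sup>2 \<Lambda> ((M q)\<^sup>2)\<close>.\<close>

lemma minimal_kernel:
  assumes L: "L \<in> forms 3 1" and min: "\<And>L'. L' \<in> forms 3 1 \<Longrightarrow> dim (K L) \<le> dim (K L')"
    and q: "q \<in> K L" and M: "M \<in> forms 3 1"
  shows "M * q \<in> W"
proof -
  have K2: "K L \<subseteq> forms 3 2" for L by (auto simp: K_def)
  have sp: "forms 3 2 \<subseteq> span (form_basis 2)" by (simp add: span_form_basis)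
  have q2: "q \<in> forms 3 2" and Lq: "L * q \<in> W" using q by (auto simp: K_def)
  obtain B where B: "finite B" "independent B" "B \<subseteq> forms 3 2" "card B + dim (K L) = dim (forms 3 2)"
    "K L \<inter> span B = {0}"
    by (rule complement_exists[OF subspace_K[of L] subspace_forms[of 3 2] K2 sp finite_form_basis]) (rule that)
  have D2: "d \<in> forms 3 2" if "d \<in> span B" for d
    using that B(3) span_minimal[OF B(3) subspace_forms] by blast
  have N0: "\<Lambda> (N * d * (N * d)) \<ge> 0" if "N \<in> forms 3 1" "d \<in> forms 3 2" for N d
    by (rule nonneg_square[OF forms_1_2[OF that]])
  interpret BL: psd_form "\<lambda>u v. \<Lambda> (L * u * (L * v))" "span B"
    by (rule psd_form_pull[OF linear_times]) (use D2 forms_1_2[OF L] in auto)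
  have nullL: "d = 0" if "d \<in> span B" "\<Lambda> (L * d * (L * d)) = 0" for d
    using null_in_W[OF forms_1_2[OF L D2[OF that(1)]] that(2)] that(1) D2 B(5) by (auto simp: K_def)
  have "\<exists>C\<ge>0. \<forall>d\<in>span B. \<bar>\<Lambda> (M * d * (M * d))\<bar> \<le> C * \<Lambda> (L * d * (L * d))"
  proof (rule BL.domination[OF subspace_span B(1) span_superset bilinear_pull[OF linear_times linear_times, of M M]])
    show "\<Lambda> (M * u * (M * v)) = \<Lambda> (M * v * (M * u))" for u v by (simp add: mult.commute)
    show "\<Lambda> (M * u * (M * w)) = 0" if "u \<in> span B" "\<Lambda> (L * u * (L * u)) = 0" for u w
      using nullL[OF that] by (simp add: L_simps)
  qed
  then obtain C where C: "C \<ge> 0" "\<And>d. d \<in> span B \<Longrightarrow> \<Lambda> (M * d * (M * d)) \<le> C * \<Lambda> (L * d * (L * d))"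
    by fastforce
  \<comment> \<open>This makes \<open>4 * C * t\<^sup>2\<close> equal to
    \<open>C / (C + 1)\<^sup>2 < 1\<close>, the contraction factor of the final estimate.\<close>
  define t where "t = 1 / (2 * (C + 1))"
  have t: "t \<noteq> 0" "4 * C * t\<^sup>2 < 1"
  proof -
    have "t\<^sup>2 = 1 / (4 * (C + 1)\<^sup>2)" unfolding t_def power_divide power_mult_distrib by (simp only: power_one) simp
    then have "4 * C * t\<^sup>2 = C / (C + 1)\<^sup>2" by simp
    also have "\<dots> < 1"
    proof (subst divide_less_eq_1_pos)
      show "0 < (C + 1)\<^sup>2" using C(1) by simp
      show "C < (C + 1)\<^sup>2" using C(1) by (simp add: power2_sum add_nonneg_pos)
    qed
    finally show "4 * C * t\<^sup>2 < 1" .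
    show "t \<noteq> 0" using C(1) by (simp add: t_def)
  qed
  define N where "N = L + t *\<^sub>R M"
  have N: "N \<in> forms 3 1" unfolding N_def by (intro forms_add forms_scale L M)
  \<comment> \<open>Parallelogram identity for \<open>L * d = N * d - t M * d\<close>. Definiteness
    on the complement \<open>span B\<close> thereby passes from \<open>L\<close> to
    \<open>N\<close>.\<close>
  have lower: "\<Lambda> (L * d * (L * d)) \<le> 4 * \<Lambda> (N * d * (N * d))" if d: "d \<in> span B" for d
  proof -
    let ?f = "(N * d) + t *\<^sub>R (M * d)"
    have f3: "?f \<in> forms 3 3" by (intro forms_add forms_scale forms_1_2 N M D2 d)
    have id: "2 *\<^sub>R (N * d * (N * d)) + (2 * t\<^sup>2) *\<^sub>R (M * d * (M * d)) = L * d * (L * d) + ?f * ?f"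
      unfolding N_def scaleR_const power2_eq_square const_simps by algebra
    have "2 * \<Lambda> (N * d * (N * d)) + 2 * t\<^sup>2 * \<Lambda> (M * d * (M * d)) = \<Lambda> (L * d * (L * d)) + \<Lambda> (?f * ?f)"
      using arg_cong[OF id, of \<Lambda>] by (simp only: L_simps real_scaleR_def)
    then have "\<Lambda> (L * d * (L * d)) \<le> 2 * \<Lambda> (N * d * (N * d)) + 2 * t\<^sup>2 * \<Lambda> (M * d * (M * d))"
      using nonneg_square[OF f3] by linarith
    also have "2 * t\<^sup>2 * \<Lambda> (M * d * (M * d)) \<le> 2 * t\<^sup>2 * (C * \<Lambda> (L * d * (L * d)))"
      using C(2)[OF d] by (intro mult_left_mono) auto
    also have "2 * t\<^sup>2 * (C * \<Lambda> (L * d * (L * d))) = (4 * C * t\<^sup>2) * \<Lambda> (L * d * (L * d)) / 2" by simp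
    also have "\<dots> \<le> 1 * \<Lambda> (L * d * (L * d)) / 2"
      using t(2) N0[OF L D2[OF d]] by (intro divide_right_mono mult_right_mono) auto
    finally show ?thesis by simp
  qed
  have "K N \<inter> span B = {0}"
  proof -
    have "d = 0" if "d \<in> K N" "d \<in> span B" for d
    proof -
      have "\<Lambda> (N * d * (N * d)) = 0" using that(1) forms_1_2[OF N] by (auto simp: K_def intro: W_orth)
      then show ?thesis using nullL[OF that(2)] lower[OF that(2)] N0[OF L D2[OF that(2)]] by simp
    qed
    then show ?thesis using subspace_0[OF subspace_K] span_zero by blast
  qed
  moreover have "dim (span B) = card B" using dim_span_eq_card_independent[OF B(2)] .
  \<comment> \<open>Minimality of \<open>L\<close> enters here: \<open>K N\<close> meets
    \<open>span B\<close> only in 0 and is at least as large as \<open>K L\<close>, so it is a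
    complement of \<open>span B\<close> too.\<close>
  ultimately have "\<exists>v\<in>K N. \<exists>u\<in>span B. q = v + u"
    using min[OF N] B(4) q2 D2
    by (intro sum_eq_of_dim[OF subspace_K subspace_span K2 _ sp finite_form_basis]) auto
  then obtain r d where r: "r \<in> K N" and d: "d \<in> span B" and qrd: "q = r + d" by blast
  have r2: "r \<in> forms 3 2" and Nr: "N * r \<in> W" using r by (auto simp: K_def)
  note d2 = D2[OF d]
  have Md: "M * d \<in> forms 3 3" and Mq: "M * q \<in> forms 3 3" and Mr: "M * r \<in> forms 3 3"
    and Nd: "N * d \<in> forms 3 3" and Nq: "N * q \<in> forms 3 3"
    by (intro forms_1_2 M N d2 q2 r2)+
  \<comment> \<open>Regrouping \<open>L * r * (M * q)\<close> as \<open>L * q * (M * r)\<close>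
    exposes a factor in \<open>W\<close>; as \<open>N * r\<close> lies in \<open>W\<close> as well,
    only the term with \<open>t\<close> is left, and it must vanish.\<close>
  have "\<Lambda> (N * r * (M * q)) = \<Lambda> (L * q * (M * r)) + t * \<Lambda> (M * r * (M * q))"
  proof -
    have "N * r * (M * q) = L * q * (M * r) + t *\<^sub>R (M * r * (M * q))"
      unfolding N_def scaleR_const by algebra
    then show ?thesis by (simp add: L_simps)
  qed
  then have orth: "\<Lambda> (M * r * (M * q)) = 0"
    using W_orth(1)[OF Nr Mq] W_orth(1)[OF Lq Mr] t(1) by simp
  have le: "\<Lambda> (M * q * (M * q)) \<le> \<Lambda> (M * d * (M * d))"
  proof -
    have "M * d * (M * d) = M * q * (M * q) + M * r * (M * r) - 2 *\<^sub>R (M * r * (M * q))"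
      unfolding qrd scaleR_const const_simps by algebra
    then have "\<Lambda> (M * d * (M * d)) = \<Lambda> (M * q * (M * q)) + \<Lambda> (M * r * (M * r))"
      using orth by (simp add: L_simps)
    then show ?thesis using nonneg_square[OF Mr] by simp
  qed
  have "\<Lambda> (N * d * (N * d)) = t\<^sup>2 * \<Lambda> (M * q * (M * q))"
  proof -
    \<comment> \<open>Since \<open>N * d = L * q + t M * q - N * r\<close>, and \<open>L * q\<close>
      and \<open>N * r\<close> lie in \<open>W\<close>, only the square of \<open>t M * q\<close>
      counts.\<close>
    have "N * d * (N * d) = (t\<^sup>2) *\<^sub>R (M * q * (M * q)) + L * q * (L * q + (2 * t) *\<^sub>R (M * q)) - N * r * (N * q + N * d)"
      unfolding N_def qrd scaleR_const power2_eq_square const_simps by algebra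
    moreover have "\<Lambda> (L * q * (L * q + (2 * t) *\<^sub>R (M * q))) = 0"
      by (intro W_orth(1)[OF Lq] forms_add forms_scale Mq W_forms[OF Lq])
    moreover have "\<Lambda> (N * r * (N * q + N * d)) = 0" by (intro W_orth(1)[OF Nr] forms_add Nq Nd)
    ultimately show ?thesis by (simp only: L_simps) simp
  qed
  then have "\<Lambda> (M * q * (M * q)) \<le> 4 * C * t\<^sup>2 * \<Lambda> (M * q * (M * q))"
    using le C(2)[OF d] mult_left_mono[OF lower[OF d] C(1)] by simp
  moreover have "4 * C * t\<^sup>2 * \<Lambda> (M * q * (M * q)) < 1 * \<Lambda> (M * q * (M * q))"
    if "\<Lambda> (M * q * (M * q)) > 0"
    using t(2) that by (rule mult_strict_right_mono)
  ultimately have "\<Lambda> (M * q * (M * q)) = 0" using nonneg_square[OF Mq] by fastforce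
  then show ?thesis by (rule null_in_W[OF Mq])
qed

lemma real_zero_of_dim_ge_4:
  assumes dim: "dim W \<ge> 4" and nz: "\<not> forms 3 3 \<subseteq> W"
  shows has_real_zero
proof -
  obtain L where L: "L \<in> forms 3 1" and min: "\<And>L'. L' \<in> forms 3 1 \<Longrightarrow> dim (K L) \<le> dim (K L')"
    using ex_has_least_nat[of "\<lambda>L. L \<in> forms 3 1" "var 0" "\<lambda>L. dim (K L)"] var_in_forms[of 0 3] by auto
  show ?thesis
  proof (cases "K L \<subseteq> {0}")
    case False
    then obtain q where q: "q \<in> K L" "q \<noteq> 0" by blast
    have "q * M \<in> W" if "M \<in> forms 3 1" for M
      using minimal_kernel[OF L min q(1) that] by (simp add: mult.commute)
    then show ?thesis using conic_real_zero[of q] q nz by (auto simp: K_def)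
  next
    case True
    let ?U = "(*) L ` forms 3 2"
    have "L \<noteq> 0"
    proof
      assume "L = 0"
      then have "K L = forms 3 2" by (auto simp: K_def subspace_0[OF subspace_W])
      then have "forms 3 2 \<subseteq> {0}" using True by simp
      then have "dim (forms 3 2) \<le> card ({}::poly_R set)" by (intro dim_le_card) auto
      then show False by (simp add: dim_forms_3_values)
    qed
    then have inj: "inj ((*) L)" by (auto intro: injI)
    have dimU: "dim ?U = 6"
    proof -
      have "?U = span ((*) L ` form_basis 2)"
        by (simp add: linear_span_image[OF linear_times] span_form_basis)
      moreover have "independent ((*) L ` form_basis 2)"
        by (rule linear_independent_injective_image[OF linear_times independent_form_basis])
          (use inj inj_on_subset in blast)
      ultimately have "dim ?U = card ((*) L ` form_basis 2)" by (simp add: dim_eq_card_independent)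
      also have "\<dots> = card (form_basis 2)" using inj inj_on_subset by (intro card_image) blast
      also have "\<dots> = dim (forms 3 2)"
        using dim_span_eq_card_independent[OF independent_form_basis[of 2]] by (simp add: span_form_basis)
      finally show ?thesis by (simp add: dim_forms_3_values)
    qed
    have "\<exists>w\<in>W. \<exists>u\<in>?U. h = w + u" if h: "h \<in> forms 3 3" for h
    proof (rule sum_eq_of_dim[OF subspace_W, of ?U "forms 3 3" "form_basis 3"])
      show "subspace ?U" by (rule linear_subspace_image[OF linear_times subspace_forms])
      show "W \<inter> ?U = {0}"
      proof -
        have "L * q = 0" if "q \<in> forms 3 2" "L * q \<in> W" for q using True that by (auto simp: K_def)
        moreover have "0 \<in> W" "0 \<in> ?U"
          using subspace_0[OF subspace_W] subspace_0[OF subspace_forms] by force+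
        ultimately show ?thesis by auto
      qed
      show "dim (forms 3 3) \<le> dim W + dim ?U" using dim dimU by (simp add: dim_forms_3_values)
    qed (use h W_forms forms_1_2[OF L] span_form_basis finite_form_basis in auto)
    then show ?thesis by (intro flat_real_zero[OF L _ nz]) blast
  qed
qed

end

section \<open>Extreme rays\<close>

text \<open>Moves one variable at a time from the left factor into the functional. For
  \<open>d = e = 3\<close> it shows that \<open>W\<close> is not all of the cubics unless
  \<open>\<Lambda>\<close> vanishes on sextics.\<close>

lemma functional_vanishes_on_products:
  assumes "linear \<phi>" "\<And>a b. a \<in> forms 3 d \<Longrightarrow> b \<in> forms 3 e \<Longrightarrow> \<phi> (a * b) = (0::real)" "p \<in> forms 3 (d + e)"
  shows "\<phi> p = 0"
  using assms
proof (induction d arbitrary: \<phi> p)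
  case 0
  then show ?case using one_in_forms[of 3] by (metis add_0 mult_1)
next
  case (Suc d)
  obtain a b c where abc: "a \<in> forms 3 (d + e)" "b \<in> forms 3 (d + e)" "c \<in> forms 3 (d + e)"
    "p = var 0 * a + var 1 * b + var 2 * c"
    using forms_3_Suc[of p "d + e"] Suc.prems(3) by auto
  have "\<phi> (var i * q) = 0" if i: "i < 3" and q: "q \<in> forms 3 (d + e)" for i q
  proof (rule Suc.IH[of "\<lambda>q. \<phi> (var i * q)", OF _ _ q])
    show "linear (\<lambda>q. \<phi> (var i * q))"
      using Suc.prems(1) by (simp add: linear_iff distrib_left)
    show "\<phi> (var i * (a * b)) = 0" if "a \<in> forms 3 d" "b \<in> forms 3 e" for a b
      using Suc.prems(2)[of "var i * a" b] forms_mult'[OF var_in_forms[OF i] that(1)] that(2)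
      by (simp add: mult.assoc)
  qed
  then show ?case using abc Suc.prems(1) by (simp add: linear_add)
qed

lemma dual_space_linear_extension:
  assumes "l \<in> dual_space (span B)" "independent B"
  obtains \<phi> where "linear \<phi>" "\<And>p. p \<in> span B \<Longrightarrow> \<phi> p = l p"
proof -
  obtain \<phi> where \<phi>: "linear \<phi>" "\<forall>b\<in>B. \<phi> b = l b"
    using linear_independent_extend[OF assms(2)] by blast
  have l: "\<And>p q. p \<in> span B \<Longrightarrow> q \<in> span B \<Longrightarrow> l (p + q) = l p + l q" "\<And>c p. p \<in> span B \<Longrightarrow> l (c *\<^sub>R p) = c * l p"
    using assms(1) by (auto simp: dual_space_def)
  have "p \<in> span B \<and> \<phi> p = l p" if "p \<in> span B" for p
    using that
  proof (induction rule: span_induct_alt)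
    case base
    show ?case using l(2)[OF span_zero, of 0] \<phi>(1) by (simp add: linear_0 span_zero)
  next
    case (step c x y)
    then show ?case
      using l \<phi> by (simp add: linear_add linear_scale span_base span_scale span_add)
  qed
  then show ?thesis using that \<phi>(1) by blast
qed

text \<open>Brings a linear map on the ambient space back to the encoding of
  \<open>dual_space\<close>.\<close>

definition restrict_functional :: "'a set \<Rightarrow> ('a \<Rightarrow> real) \<Rightarrow> 'a \<Rightarrow> real" where
  "restrict_functional V \<phi> = (\<lambda>p. if p \<in> V then \<phi> p else 0)"

lemma restrict_functional_dual_space:
  "subspace V \<Longrightarrow> linear \<phi> \<Longrightarrow> restrict_functional V \<phi> \<in> dual_space V"
  by (auto simp: dual_space_def restrict_functional_def linear_add linear_scale subspace_add subspace_scale)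

lemma restrict_functional_sos_dual:
  assumes "linear \<phi>" "\<And>f. f \<in> forms 3 3 \<Longrightarrow> 0 \<le> \<phi> (f * f)"
  shows "restrict_functional (forms 3 6) \<phi> \<in> sos_dual 3 3"
proof -
  have nonneg: "0 \<le> \<phi> (\<Sum>q\<leftarrow>qs. q\<^sup>2)" if "set qs \<subseteq> forms 3 3" for qs
    using that assms by (induction qs) (auto simp: linear_0 linear_add power2_eq_square)
  then show ?thesis
    using restrict_functional_dual_space[OF subspace_forms assms(1), of 3 6]
    by (auto simp: sos_dual_def sos_forms_def restrict_functional_def)
qed

section \<open>Rank of the quadratic form and consequences of extremality\<close>

context sextic_functional
begin

definition \<Phi> :: "poly_R \<Rightarrow> poly_R \<Rightarrow> real" where
  "\<Phi> f = (\<lambda>g. if g \<in> forms 3 3 then \<Lambda> (f * g) else 0)"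

lemma linear_\<Phi>: "linear \<Phi>"
  by (auto simp: linear_iff \<Phi>_def fun_eq_iff scaleR_fun_def distrib_right L_simps)

lemma \<Phi>_eq_0: "f \<in> forms 3 3 \<Longrightarrow> \<Phi> f = 0 \<longleftrightarrow> f \<in> W"
  by (auto simp: \<Phi>_def W_def fun_eq_iff)

lemma rank_nullity: "dim (\<Phi> ` forms 3 3) + dim W = 10"
proof -
  obtain B where B: "finite B" "independent B" "B \<subseteq> forms 3 3" "card B + dim W = dim (forms 3 3)"
    "W \<inter> span B = {0}" "\<And>h. h \<in> forms 3 3 \<Longrightarrow> \<exists>v\<in>W. \<exists>d\<in>span B. h = v + d"
    by (rule complement_exists[OF subspace_W subspace_forms[of 3 3], of "form_basis 3"])
      (auto simp: W_def span_form_basis finite_form_basis)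
  have sp: "span B \<subseteq> forms 3 3" by (rule span_minimal[OF B(3) subspace_forms])
  have inj: "inj_on \<Phi> (span B)"
  proof (rule inj_onI)
    fix x y assume xy: "x \<in> span B" "y \<in> span B" "\<Phi> x = \<Phi> y"
    then have "\<Phi> (x - y) = 0" by (simp add: linear_diff[OF linear_\<Phi>])
    moreover have "x - y \<in> span B" using xy by (simp add: span_diff)
    ultimately show "x = y" using \<Phi>_eq_0 sp B(5) by (metis IntI eq_iff_diff_eq_0 singletonD subsetD)
  qed
  have "\<Phi> ` forms 3 3 = span (\<Phi> ` B)"
  proof -
    have "\<Phi> h \<in> \<Phi> ` span B" if h: "h \<in> forms 3 3" for h
    proof -
      obtain v d where "v \<in> W" "d \<in> span B" "h = v + d" using B(6)[OF h] by blast
      then show ?thesis using \<Phi>_eq_0[OF W_forms] by (simp add: linear_add[OF linear_\<Phi>])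
    qed
    then show ?thesis using sp by (auto simp: linear_span_image[OF linear_\<Phi>])
  qed
  moreover have "independent (\<Phi> ` B)"
    by (rule linear_independent_injective_image[OF linear_\<Phi> B(2) inj])
  moreover have "card (\<Phi> ` B) = card B"
    by (rule card_image[OF inj_on_subset[OF inj span_superset]])
  ultimately have "dim (\<Phi> ` forms 3 3) = card B" by (simp add: dim_eq_card_independent)
  then show ?thesis using B(4) by (simp add: dim_forms_3_values)
qed

text \<open>Evaluation is multiplicative, so every \<open>\<Phi> f\<close> is a multiple of the
  single functional \<open>e\<close>; \<open>f0\<close> shows that \<open>c\<close> and
  \<open>e\<close> are not 0.\<close>

lemma rank_one_of_point_evaluation:
  assumes ev: "\<And>p. p \<in> forms 3 6 \<Longrightarrow> ev a p = c * \<Lambda> p" and f0: "f0 \<in> forms 3 3" "ev a f0 \<noteq> 0"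
  shows "dim (\<Phi> ` forms 3 3) = 1"
proof -
  define e where "e = (\<lambda>g. if g \<in> forms 3 3 then ev a g else 0)"
  have "c \<noteq> 0" using ev[OF forms_3_3[OF f0(1) f0(1)]] f0(2) by (auto simp: ev_mult)
  then have \<Phi>: "\<Phi> f = (ev a f / c) *\<^sub>R e" if "f \<in> forms 3 3" for f
    using ev[OF forms_3_3[OF that]] by (auto simp: \<Phi>_def e_def fun_eq_iff scaleR_fun_def ev_mult field_simps)
  have "\<Phi> ` forms 3 3 = span {e}"
  proof
    show "\<Phi> ` forms 3 3 \<subseteq> span {e}" using \<Phi> by (auto simp: span_singleton)
    show "span {e} \<subseteq> \<Phi> ` forms 3 3"
    proof
      fix u assume "u \<in> span {e}"
      then obtain k where k: "u = k *\<^sub>R e" by (auto simp: span_singleton)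
      let ?f = "(k * c / ev a f0) *\<^sub>R f0"
      have "?f \<in> forms 3 3" by (rule forms_scale[OF f0(1)])
      moreover have "u = \<Phi> ?f" using \<Phi>[OF calculation] \<open>c \<noteq> 0\<close> f0(2) by (simp add: k ev_simps)
      ultimately show "u \<in> \<Phi> ` forms 3 3" by blast
    qed
  qed
  moreover have "e f0 \<noteq> 0" using f0 by (simp add: e_def)
  then have "e \<noteq> 0" by auto
  ultimately show ?thesis by (simp add: dim_eq_card_independent)
qed

lemma proportional_of_extreme:
  assumes extreme: "spans_extreme_ray (restrict_functional (forms 3 6) \<Lambda>) (sos_dual 3 3)"
    and \<phi>: "linear \<phi>" "\<And>f g. f \<in> W \<Longrightarrow> g \<in> forms 3 3 \<Longrightarrow> \<phi> (f * g) = 0"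
  obtains c where "\<And>p. p \<in> forms 3 6 \<Longrightarrow> \<phi> p = c * \<Lambda> p"
proof -
  let ?r = "restrict_functional (forms 3 6)"
  interpret B: psd_form "\<lambda>u v. \<Lambda> (id u * id v)" "forms 3 3"
    by (rule psd_form_pull) (auto simp: linear_ident)
  have bil: "bilinear (\<lambda>u v::poly_R. \<phi> (u * v))"
    using \<phi>(1) by (simp add: bilinear_def linear_iff distrib_left distrib_right)
  have "\<exists>C\<ge>0. \<forall>u\<in>span (form_basis 3). \<bar>\<phi> (u * u)\<bar> \<le> C * \<Lambda> (id u * id u)"
  proof (rule B.domination[OF subspace_forms finite_form_basis _ bil])
    show "form_basis 3 \<subseteq> forms 3 3" using span_superset[of "form_basis 3"] by (simp add: span_form_basis)
    show "\<phi> (u * v) = \<phi> (v * u)" for u v by (simp add: mult.commute)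
    show "\<phi> (u * w) = 0" if "u \<in> span (form_basis 3)" "w \<in> span (form_basis 3)" "\<Lambda> (id u * id u) = 0" for u w
      using that by (intro \<phi>(2) null_in_W) (simp_all add: span_form_basis)
  qed
  then obtain C where C: "C \<ge> 0" "\<And>f. f \<in> forms 3 3 \<Longrightarrow> \<bar>\<phi> (f * f)\<bar> \<le> C * \<Lambda> (f * f)"
    by (auto simp: span_form_basis)
  define \<epsilon> where "\<epsilon> = 1 / (C + 1)"
  have \<epsilon>: "\<epsilon> > 0" "\<epsilon> * C \<le> 1" using C(1) by (auto simp: \<epsilon>_def)
  have bound: "\<epsilon> * \<bar>\<phi> (f * f)\<bar> \<le> \<Lambda> (f * f)" if f: "f \<in> forms 3 3" for f
  proof -
    have "\<epsilon> * \<bar>\<phi> (f * f)\<bar> \<le> (\<epsilon> * C) * \<Lambda> (f * f)"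
      using mult_left_mono[OF C(2)[OF f], of \<epsilon>] \<epsilon>(1) by (simp add: mult.assoc)
    also have "\<dots> \<le> 1 * \<Lambda> (f * f)"
      by (rule mult_right_mono[OF \<epsilon>(2) nonneg_square[OF f]])
    finally show ?thesis by simp
  qed
  have mem: "?r (\<lambda>p. \<Lambda> p + k * \<phi> p) \<in> sos_dual 3 3" if "\<bar>k\<bar> = \<epsilon>" for k
  proof (rule restrict_functional_sos_dual)
    show "linear (\<lambda>p. \<Lambda> p + k * \<phi> p)"
      using lin \<phi>(1) by (simp add: linear_iff algebra_simps)
    fix f assume f: "f \<in> forms 3 3"
    have "\<bar>k * \<phi> (f * f)\<bar> \<le> \<Lambda> (f * f)" using bound[OF f] that by (simp add: abs_mult)
    then show "0 \<le> \<Lambda> (f * f) + k * \<phi> (f * f)" by linarith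
  qed
  let ?a = "?r (\<lambda>p. \<Lambda> p + \<epsilon> * \<phi> p)" and ?b = "?r (\<lambda>p. \<Lambda> p + (- \<epsilon>) * \<phi> p)"
  have a: "?a \<in> sos_dual 3 3" and b: "?b \<in> sos_dual 3 3" by (rule mem, use \<epsilon>(1) in simp)+
  show ?thesis
  \<comment> \<open>An open segment needs distinct end points; equal ones mean that
    \<open>\<phi>\<close> is 0 on sextics.\<close>
  proof (cases "?a = ?b")
    case True
    have "\<phi> p = 0 * \<Lambda> p" if "p \<in> forms 3 6" for p
      using fun_cong[OF True, of p] that \<epsilon>(1) by (simp add: restrict_functional_def)
    then show ?thesis by (rule that)
  next
    case False
    have mid: "?r \<Lambda> = (1 - 1 / 2) *\<^sub>R ?a + (1 / 2) *\<^sub>R ?b"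
      by (rule ext) (simp add: restrict_functional_def scaleR_fun_def field_simps)
    have seg: "?r \<Lambda> \<in> open_segment ?a ?b"
      unfolding in_segment using False mid by (intro conjI exI[of _ "1/2"]) simp_all
    have face: "(cone hull {?r \<Lambda>}) face_of (sos_dual 3 3)"
      using extreme by (simp add: spans_extreme_ray_def)
    have "?a \<in> cone hull {?r \<Lambda>}"
      using face_ofD[OF face seg a b] hull_inc[of "?r \<Lambda>"] by simp
    then obtain c where c: "?a = c *\<^sub>R ?r \<Lambda>" by (auto simp: cone_hull_expl)
    have "\<phi> p = (c - 1) / \<epsilon> * \<Lambda> p" if "p \<in> forms 3 6" for p
      using fun_cong[OF c, of p] that \<epsilon>(1) by (simp add: restrict_functional_def scaleR_fun_def field_simps)
    then show ?thesis by (rule that)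
  qed
qed

lemma dim_W_ge_3:
  assumes extreme: "spans_extreme_ray (restrict_functional (forms 3 6) \<Lambda>) (sos_dual 3 3)"
    and g0: "g0 \<in> forms 3 6" "\<Lambda> g0 \<noteq> 0"
  shows "dim W \<ge> 3"
proof (rule ccontr)
  assume "\<not> dim W \<ge> 3"
  then have dimW: "dim W \<le> 2" by simp
  have Wsp: "W \<subseteq> span (form_basis 3)" using W_forms by (auto simp: span_form_basis)
  obtain B where B: "finite B" "B \<subseteq> W" "independent B" "span B = W" "card B = dim W"
    by (rule finite_basis[OF subspace_W Wsp finite_form_basis])
  define P where "P = (\<lambda>(w, b). w * b) ` (B \<times> form_basis 3)"
  have finP: "finite P" using B(1) by (simp add: P_def finite_form_basis)
  have "card (form_basis 3) = dim (forms 3 3)"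
    using dim_span_eq_card_independent[OF independent_form_basis[of 3]] by (simp add: span_form_basis)
  then have "card P \<le> 20"
    using card_image_le[of "B \<times> form_basis 3" "\<lambda>(w, b). w * b"] dimW B(1,5)
    by (simp add: P_def finite_form_basis dim_forms_3_values)
  \<comment> \<open>Including \<open>g0\<close> rules out \<open>\<Lambda>\<close> itself: the
    functional found below vanishes at \<open>g0\<close>, so it can be proportional to
    \<open>\<Lambda>\<close> only as 0, yet it is 1 at \<open>h\<close>.\<close>
  then have "card (insert g0 P) \<le> 21" using card_insert_le_m1[of 21 P g0] by simp
  then have "\<not> forms 3 6 \<subseteq> span (insert g0 P)"
    using dim_le_card[of "forms 3 6" "insert g0 P"] finP by (auto simp: dim_forms_3_values)
  then obtain h where h: "h \<in> forms 3 6" "h \<notin> span (insert g0 P)" by blast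
  obtain T where T: "T \<subseteq> insert g0 P" "independent T" "insert g0 P \<subseteq> span T" "card T = dim (insert g0 P)"
    by (rule basis_exists[of "insert g0 P"])
  have hT: "h \<notin> span T" using h(2) span_mono[OF T(1)] by blast
  have "independent (insert h T)" by (rule independent_insertI[OF hT T(2)])
  from linear_independent_extend[OF this, of "\<lambda>x. if x = h then 1 else 0 :: real"]
  obtain \<phi> where \<phi>: "linear \<phi>" "\<forall>x\<in>insert h T. \<phi> x = (if x = h then 1 else 0 :: real)"
    by (elim exE conjE)
  have "h \<notin> T" using hT span_base by blast
  then have T0: "\<phi> x = 0" if "x \<in> T" for x using that \<phi>(2) by auto
  have zero: "\<phi> x = 0" if "x \<in> insert g0 P" for x
    using linear_eq_0_on_span[OF \<phi>(1) T0] T(3) that by blast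
  have "\<phi> (w * g) = 0" if w: "w \<in> W" and g: "g \<in> forms 3 3" for w g
  proof -
    have 1: "\<phi> (w * g) = 0" if w: "w \<in> B" for w
    proof (rule linear_eq_0_on_span[of "\<lambda>g. \<phi> (w * g)" "form_basis 3"])
      show "linear (\<lambda>g. \<phi> (w * g))" using \<phi>(1) by (simp add: linear_iff distrib_left)
      show "\<phi> (w * b) = 0" if "b \<in> form_basis 3" for b
        using that w by (intro zero) (auto simp: P_def)
    qed (use g in \<open>simp add: span_form_basis\<close>)
    show ?thesis
    proof (rule linear_eq_0_on_span[of "\<lambda>w. \<phi> (w * g)" B])
      show "linear (\<lambda>w. \<phi> (w * g))" using \<phi>(1) by (simp add: linear_iff distrib_right)
    qed (use 1 w B(4) in auto)
  qed
  then obtain c where c: "\<And>p. p \<in> forms 3 6 \<Longrightarrow> \<phi> p = c * \<Lambda> p"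
    using proportional_of_extreme[OF extreme \<phi>(1)] by blast
  have "c = 0" using c[OF g0(1)] zero[of g0] g0(2) by simp
  then show False using c[OF h(1)] \<phi>(2) by simp
qed

end

theorem theorem1p6:
  fixes l :: "poly_R \<Rightarrow> real"
  assumes "spans_extreme_ray l (sos_dual 3 3)"
  shows "quadratic_rank (forms 3 3) (Q_form l) = 1 \<or> quadratic_rank (forms 3 3) (Q_form l) = 7"
proof -
  have "l \<in> cone hull {l}" by (simp add: hull_inc)
  then have l: "l \<in> sos_dual 3 3" and "l \<noteq> 0"
    using assms face_of_imp_subset by (auto simp: spans_extreme_ray_def)
  have l6: "l \<in> dual_space (span (form_basis 6))"
    using l by (simp add: sos_dual_def span_form_basis)
  obtain \<Lambda> where \<Lambda>: "linear \<Lambda>" "\<And>p. p \<in> forms 3 6 \<Longrightarrow> \<Lambda> p = l p"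
    by (rule dual_space_linear_extension[OF l6 independent_form_basis]) (simp add: span_form_basis)
  have l_eq: "restrict_functional (forms 3 6) \<Lambda> = l"
    using l6 \<Lambda>(2) by (auto simp: restrict_functional_def dual_space_def span_form_basis)
  interpret sextic_functional \<Lambda>
  proof (rule sextic_functional.intro)
    fix f assume f: "f \<in> forms 3 3"
    then have "f * f \<in> sos_forms 3 3"
      using forms_3_3[OF f f] by (auto simp: sos_forms_def power2_eq_square intro!: exI[of _ "[f]"])
    then show "0 \<le> \<Lambda> (f * f)" using l \<Lambda>(2) forms_3_3[OF f f] by (simp add: sos_dual_def)
  qed (rule \<Lambda>(1))
  note extreme = assms[folded l_eq]
  obtain g0 where g0: "g0 \<in> forms 3 6" "\<Lambda> g0 \<noteq> 0"
  proof -
    obtain p where "l p \<noteq> 0" using \<open>l \<noteq> 0\<close> by (auto simp: fun_eq_iff)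
    then show ?thesis using that[of p] unfolding l_eq[symmetric]
      by (auto simp: restrict_functional_def split: if_splits)
  qed
  have nz: "\<not> forms 3 3 \<subseteq> W"
  proof
    assume "forms 3 3 \<subseteq> W"
    then have "\<Lambda> (a * b) = 0" if "a \<in> forms 3 3" "b \<in> forms 3 3" for a b
      using that W_orth(1) by blast
    from functional_vanishes_on_products[OF lin this] g0 show False by simp
  qed
  have "polar_form (Q_form l) f g = \<Lambda> (f * g)" if f: "f \<in> forms 3 3" and g: "g \<in> forms 3 3" for f g
  proof -
    have fg: "f + g \<in> forms 3 3" by (rule forms_add[OF f g])
    have "(f + g) * (f + g) = f * f + 2 *\<^sub>R (f * g) + g * g"
      unfolding scaleR_const const_simps by algebra
    then have "\<Lambda> ((f + g) * (f + g)) = \<Lambda> (f * f) + 2 * \<Lambda> (f * g) + \<Lambda> (g * g)" by (simp add: L_simps)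
    then show ?thesis
      using \<Lambda>(2)[OF forms_3_3[OF f f]] \<Lambda>(2)[OF forms_3_3[OF g g]] \<Lambda>(2)[OF forms_3_3[OF fg fg]]
      by (simp add: polar_form_def Q_form_def power2_eq_square)
  qed
  then have "(\<lambda>f g. if g \<in> forms 3 3 then polar_form (Q_form l) f g else 0) ` forms 3 3 = \<Phi> ` forms 3 3"
    by (intro image_cong) (auto simp: \<Phi>_def)
  then have rank: "quadratic_rank (forms 3 3) (Q_form l) = dim (\<Phi> ` forms 3 3)"
    by (simp add: quadratic_rank_def)
  show ?thesis
  proof (cases "dim W \<ge> 4")
    case True
    then obtain a f0 where a: "\<And>f. f \<in> W \<Longrightarrow> ev a f = 0" and f0: "f0 \<in> forms 3 3" "ev a f0 \<noteq> 0"
      using real_zero_of_dim_ge_4 nz unfolding has_real_zero_def by blast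
    obtain c where "\<And>p. p \<in> forms 3 6 \<Longrightarrow> ev a p = c * \<Lambda> p"
      by (rule proportional_of_extreme[OF extreme linear_ev[of a]]) (auto simp: ev_mult a)
    then show ?thesis using rank_one_of_point_evaluation[OF _ f0] rank by auto
  next
    case False
    then have "dim W = 3" using dim_W_ge_3[OF extreme g0] by simp
    then show ?thesis using rank_nullity rank by simp
  qed
qed

end
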